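(* Let $2\le q\le\infty$ and $A=(A_1,A_2)$, $B=(B_1,B_2)$ with $A_1,A_2,B_1,B_2>0$. Let $q'$ be the conjugate exponent, $\frac1q+\frac1{q'}=1$. Then, for every nonzero $f\in L^1(\mathbb R^d)$ with $\|f\|_q<\infty$, $$\|f\|_q\lesssim \left\|\frac{f\,|x|^{A}}{\|f\|_q}\right\|_q^{\frac{B^T}{A}}\big\|\widehat f\,|\xi|^{B}\big\|_{q'},$$ where $\frac{B^T}{A}=\big(\frac{B_2}{A_1},\frac{B_1}{A_2}\big)$, so that the outer exponent is a broken power applied to the number $\big\|f|x|^A/\|f\|_q\big\|_q$.
   Context: For integrable $f:\mathbb R^d\to\mathbb C$, $\widehat f(\xi)=\int_{\mathbb R^d}f(x)e^{-2\pi i\langle x,\xi\rangle}\,dx$. Broken powers: for a pair $C=(C_1,C_2)$ and $s>0$, $s^C:=s^{C_1}$ if $s<1$ and $s^C:=s^{C_2}$ if $s\ge1$; for $x\in\mathbb R^d$, $|x|^C$ is the broken power of the number $|x|$ (Euclidean norm). Norms may take the value $+\infty$. $F\lesssim G$ means $F\le C\,G$ with a constant $C$ depending only on $d,q,A,B$ and not on $f$. *)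

theory Defs
  imports "HOL-Probability.Essential_Supremum"
begin

definition broken_powr :: "real \<times> real \<Rightarrow> real \<Rightarrow> real" where
  "broken_powr C s = (if s < 1 then s powr fst C else s powr snd C)"

(* Powers of numbers in [0, \<infinity>]. The convention top ^ a = top is the right one for a > 0 only;
   the two definitions below are used only with positive exponents. *)

definition ennreal_powr :: "ennreal \<Rightarrow> real \<Rightarrow> ennreal" where
  "ennreal_powr s a = (if s = top then top else ennreal (enn2real s powr a))"

definition broken_ennreal_powr :: "real \<times> real \<Rightarrow> ennreal \<Rightarrow> ennreal" where
  "broken_ennreal_powr C s =
     (if s < 1 then ennreal_powr s (fst C) else ennreal_powr s (snd C))"

(* The L^q norm with respect to Lebesgue measure, for exponents 1 \<le> q \<le> \<infinity>; it may be infinite. *)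

definition Lq_norm :: "ennreal \<Rightarrow> ('a::euclidean_space \<Rightarrow> complex) \<Rightarrow> ennreal" where
  "Lq_norm q f =
     (if q = top then esssup lebesgue (\<lambda>x. ennreal (norm (f x)))
      else ennreal_powr (\<integral>\<^sup>+ x. ennreal (norm (f x) powr enn2real q) \<partial>lebesgue)
             (1 / enn2real q))"

definition fourier :: "('a::euclidean_space \<Rightarrow> complex) \<Rightarrow> 'a \<Rightarrow> complex" where
  "fourier f \<xi> =
     (LINT x|lebesgue. f x * exp (- 2 * complex_of_real pi * \<i> * complex_of_real (x \<bullet> \<xi>)))"

end

theory Submission
  imports Defs "HOL-Probability.Probability"
begin

text \<open>
  Choose \<open>R\<close> so that \<open>R\<^sup>A\<close> is a large constant times the weighted norm of \<open>f\<close>; then \<open>f\<close> is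
  small in \<open>L\<^sup>q\<close> outside the ball of radius \<open>R\<close>. For a vector \<open>h\<close> of length \<open>2 R\<close>, the shifts of that
  ball by \<open>h, 2 h, \<dots>, N h\<close> miss it, so the \<open>N\<close>-th difference of \<open>f\<close> with step \<open>h\<close> agrees with \<open>f\<close> on
  the ball up to the small tails, and its \<open>L\<^sup>q\<close> norm is comparable to that of \<open>f\<close>. On the Fourier side
  the difference is multiplication by \<open>(1 - exp (- 2 \<pi> i h \<xi>))\<^sup>N\<close>, which is at most a constant times
  \<open>min 1 (R |\<xi>|)\<^sup>N\<close>, hence at most a constant times \<open>|\<xi>|\<^sup>B / (1/R)\<^sup>B\<close> once \<open>N\<close> exceeds \<open>B\<^sub>1\<close>
  and \<open>B\<^sub>2\<close>. The Hausdorff-Young inequality for the inverse transform concludes.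

  Hausdorff-Young, with a non-sharp constant, comes from real interpolation between the trivial
  \<open>L\<^sup>1\<close> to \<open>L\<^sup>\<infinity>\<close> bound and the Plancherel inequality; Gaussian regularisation transfers it to the
  inverse transform.
\<close>

section \<open>The Fourier transform of Gaussians\<close>

text \<open>Cutting f off to a ball would become a convolution on the Fourier side, which does not
  respect the weight |\<xi>|^B; a difference operator acts there as a multiplier, and the ball
  enters only through a pointwise comparison. Differences of order N are taken because the
  multiplier has to vanish at \<xi> = 0 at least as fast as the weight. The transposed quotient B^T
  / A comes from the inversion R -> 1/R: a radius below 1 is measured with A_1, while the frequency
  1/R above 1 is measured with B_2, and conversely. The transform of an integrable function need not
  be integrable, so the forward Hausdorff-Young inequality cannot be applied to it. A Gaussian
  factor makes it integrable and only lowers its modulus; the reflected transforms of the damped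
  functions converge to f almost everywhere along a subsequence, which rests on continuity of
  translations in L^1. Norms may be infinite, so the product 0 * \<infinity> has to be excluded on
  the right-hand side: by the same inequality the Fourier factor cannot vanish for nonzero
  f.\<close>

lemma exp_ii_eq_cis: "exp (- 2 * complex_of_real pi * \<i> * complex_of_real t) = cis (- (2 * pi * t))"
  by (simp add: cis_conv_exp algebra_simps)

lemma cis_inner_measurable [measurable]:
  fixes f g :: "'b \<Rightarrow> 'a::euclidean_space"
  assumes [measurable]: "f \<in> borel_measurable M" "g \<in> borel_measurable M"
  shows "(\<lambda>x. cis (- (2 * pi * (f x \<bullet> g x)))) \<in> borel_measurable M"
proof -
  have "(\<lambda>t. cis (- (2 * pi * t))) \<in> borel_measurable borel"
    by (intro borel_measurable_continuous_onI continuous_intros)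
  then show ?thesis
    by (rule measurable_compose[rotated]) measurable
qed

text \<open>For a Borel integrand the completed measure gives the same integral. This moves the
  computations to \<open>lborel\<close>, where Fubini and substitutions are applied.\<close>

lemma fourier_lborel:
  fixes f :: "'a::euclidean_space \<Rightarrow> complex"
  assumes [measurable]: "f \<in> borel_measurable borel"
  shows "fourier f \<xi> = (LINT x|lborel. f x * cis (- (2 * pi * (x \<bullet> \<xi>))))"
  unfolding fourier_def exp_ii_eq_cis
  by (rule integral_completion) measurable

lemma fourier_cong_AE:
  fixes f g :: "'a::euclidean_space \<Rightarrow> complex"
  assumes "AE x in lebesgue. f x = g x"
    and "f \<in> borel_measurable lebesgue" "g \<in> borel_measurable borel"
  shows "fourier f = fourier g"
proof
  fix \<xi> :: 'a
  have m: "(\<lambda>x. exp (- 2 * complex_of_real pi * \<i> * complex_of_real (x \<bullet> \<xi>)))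
      \<in> borel_measurable lebesgue"
    unfolding exp_ii_eq_cis by (intro measurable_completion) measurable
  show "fourier f \<xi> = fourier g \<xi>"
    unfolding fourier_def
    using assms(1) m assms(2) measurable_completion[of g lborel borel] assms(3)
    by (intro integral_cong_AE borel_measurable_times) auto
qed

lemma integrable_mult_unit:
  fixes f g :: "'a \<Rightarrow> complex"
  assumes "integrable M f" "g \<in> borel_measurable M" "\<And>x. norm (g x) \<le> 1"
  shows "integrable M (\<lambda>x. f x * g x)"
  using assms
  by (intro Bochner_Integration.integrable_bound[OF assms(1)])
     (auto simp: norm_mult mult_left_le)

lemma norm_fourier_le:
  fixes f :: "'a::euclidean_space \<Rightarrow> complex"
  assumes "integrable lborel f"
  shows "ennreal (norm (fourier f \<xi>)) \<le> (\<integral>\<^sup>+x. ennreal (norm (f x)) \<partial>lborel)"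
proof -
  have [measurable]: "f \<in> borel_measurable borel" using assms by auto
  have "integrable lborel (\<lambda>x. f x * cis (- (2 * pi * (x \<bullet> \<xi>))))"
    by (rule integrable_mult_unit[OF assms]) simp_all
  from integral_norm_bound_ennreal[OF this] show ?thesis
    by (simp add: fourier_lborel norm_mult)
qed

lemma borel_measurable_fourier [measurable]:
  fixes f :: "'a::euclidean_space \<Rightarrow> complex"
  assumes [measurable]: "f \<in> borel_measurable borel"
  shows "fourier f \<in> borel_measurable borel"
proof -
  have "(\<lambda>\<xi>. LINT x|lborel. f x * cis (- (2 * pi * (x \<bullet> \<xi>)))) \<in> borel_measurable borel"
    by (rule lborel.borel_measurable_lebesgue_integral) measurable
  then show ?thesis by (simp add: fourier_lborel[OF assms] cong: measurable_cong)
qed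

section \<open>Affine substitutions in Lebesgue integrals\<close>

lemma nn_integral_affine_euclidean:
  fixes g :: "'a::euclidean_space \<Rightarrow> ennreal"
  assumes [measurable]: "g \<in> borel_measurable borel" and c: "c \<noteq> 0"
  shows "(\<integral>\<^sup>+x. g x \<partial>lborel) = \<bar>c\<bar>^DIM('a) * (\<integral>\<^sup>+x. g (t + c *\<^sub>R x) \<partial>lborel)"
  by (subst lborel_affine[OF c, of t])
     (simp add: nn_integral_density nn_integral_distr nn_integral_cmult flip: ennreal_power)

lemma nn_integral_shift:
  fixes g :: "'a::euclidean_space \<Rightarrow> ennreal"
  assumes "g \<in> borel_measurable borel"
  shows "(\<integral>\<^sup>+x. g (t + x) \<partial>lborel) = (\<integral>\<^sup>+x. g x \<partial>lborel)"
    "(\<integral>\<^sup>+x. g (x - t) \<partial>lborel) = (\<integral>\<^sup>+x. g x \<partial>lborel)"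
    "(\<integral>\<^sup>+x. g (t - x) \<partial>lborel) = (\<integral>\<^sup>+x. g x \<partial>lborel)"
    "(\<integral>\<^sup>+x. g (- x) \<partial>lborel) = (\<integral>\<^sup>+x. g x \<partial>lborel)"
  using nn_integral_affine_euclidean[OF assms, of 1 t] nn_integral_affine_euclidean[OF assms, of 1 "-t"]
    nn_integral_affine_euclidean[OF assms, of "-1" t] nn_integral_affine_euclidean[OF assms, of "-1" 0]
  by simp_all

lemma integral_affine_euclidean:
  fixes g :: "'a::euclidean_space \<Rightarrow> complex"
  assumes [measurable]: "g \<in> borel_measurable borel" and c: "c \<noteq> 0"
  shows "(LINT x|lborel. g x) = \<bar>c\<bar>^DIM('a) *\<^sub>R (LINT x|lborel. g (t + c *\<^sub>R x))"
  by (subst lborel_affine[OF c, of t])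
     (simp add: integral_density integral_distr)

text \<open>The parameter \<open>c\<close> is an inverse width: \<open>gauss c\<close> tends to 1 as
  \<open>c\<close> tends to 0 and serves as a convergence factor on the frequency side.\<close>

definition gauss :: "real \<Rightarrow> 'a::euclidean_space \<Rightarrow> real" where
  "gauss c x = exp (- (c * norm x)\<^sup>2 / 2)"

text \<open>The Fourier transform of \<open>gauss c\<close>: for \<open>c > 0\<close>, the centred
  normal density with standard deviation \<open>c / (2 * pi)\<close> in each coordinate, hence an
  approximate identity as \<open>c\<close> tends to 0.\<close>

definition gauss_kernel :: "real \<Rightarrow> 'a::euclidean_space \<Rightarrow> real" where
  "gauss_kernel c x = (sqrt (2 * pi) / c) ^ DIM('a) * gauss (2 * pi / c) x"

lemma borel_measurable_gauss [measurable]: "gauss c \<in> borel_measurable borel"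
  unfolding gauss_def[abs_def] by measurable

lemma borel_measurable_gauss_kernel [measurable]: "gauss_kernel c \<in> borel_measurable borel"
  unfolding gauss_kernel_def[abs_def] by measurable

lemma gauss_pos: "0 < gauss c x" and gauss_le_1: "gauss c x \<le> 1"
  by (auto simp: gauss_def)

lemma gauss_kernel_pos: "0 < c \<Longrightarrow> 0 < gauss_kernel c x"
  by (simp add: gauss_kernel_def gauss_pos)

text \<open>After the substitution \<open>c * x\<close> this is the characteristic function of the
  standard normal distribution at \<open>- (2 * pi * t / c)\<close>.\<close>

lemma fourier_gauss_real:
  fixes c t :: real
  assumes c: "c > 0"
  shows "integrable lborel (\<lambda>x::real. complex_of_real (exp (- (c * x)\<^sup>2 / 2)) * cis (- (2 * pi * (x * t))))"
    and "(LINT x|lborel. complex_of_real (exp (- (c * x)\<^sup>2 / 2)) * cis (- (2 * pi * (x * t))))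
        = complex_of_real (sqrt (2 * pi) / c * exp (- (2 * pi * t / c)\<^sup>2 / 2))"
proof -
  let ?s = "- (2 * pi * t / c)"
  let ?g = "\<lambda>x::real. complex_of_real (std_normal_density x) * cis (?s * x)"
  have i: "integrable lborel ?g"
    using c by (intro integrable_mult_unit) (auto intro!: borel_measurable_continuous_onI continuous_intros)
  have "char std_normal_distribution ?s = (LINT x|lborel. ?g x)"
    by (simp add: char_def integral_density cis_conv_exp scaleR_conv_of_real mult_ac)
  then have e: "(LINT x|lborel. ?g x) = complex_of_real (exp (- ?s\<^sup>2 / 2))"
    by (simp add: char_std_normal_distribution)
  have eq: "complex_of_real (exp (- (c * x)\<^sup>2 / 2)) * cis (- (2 * pi * (x * t)))
      = complex_of_real (sqrt (2 * pi)) * ?g (0 + c * x)" for x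
    using c by (simp add: std_normal_density_def mult_ac)
  show "integrable lborel (\<lambda>x::real. complex_of_real (exp (- (c * x)\<^sup>2 / 2)) * cis (- (2 * pi * (x * t))))"
    unfolding eq using c by (intro integrable_mult_right lborel_integrable_real_affine[OF i]) auto
  have "(LINT x|lborel. ?g x) = c *\<^sub>R (LINT x|lborel. ?g (0 + c * x))"
    using lborel_integral_real_affine[of c ?g 0] c by simp
  then have "(LINT x|lborel. ?g (0 + c * x)) = complex_of_real (exp (- ?s\<^sup>2 / 2) / c)"
    using e c by (simp add: scaleR_conv_of_real field_simps)
  then show "(LINT x|lborel. complex_of_real (exp (- (c * x)\<^sup>2 / 2)) * cis (- (2 * pi * (x * t))))
        = complex_of_real (sqrt (2 * pi) / c * exp (- (2 * pi * t / c)\<^sup>2 / 2))"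
    unfolding eq by (subst integral_mult_right_zero) simp
qed

lemma norm_power2_Basis: "(norm (x::'a::euclidean_space))\<^sup>2 = (\<Sum>b\<in>Basis. (x \<bullet> b)\<^sup>2)"
  unfolding power2_norm_eq_inner by (subst euclidean_inner) (simp add: power2_eq_square)

lemma gauss_prod: "gauss c (x::'a::euclidean_space) = (\<Prod>b\<in>Basis. exp (- (c * (x \<bullet> b))\<^sup>2 / 2))"
  by (simp add: gauss_def power_mult_distrib norm_power2_Basis sum_distrib_left sum_divide_distrib
      flip: exp_sum sum_negf)

text \<open>Gaussian and character both factor over the coordinates, and \<open>lborel\<close> is
  the image of a product of one-dimensional Lebesgue measures, so Fubini reduces both claims to
  dimension one.\<close>

lemma fourier_gauss:
  fixes z :: "'a::euclidean_space"
  assumes c: "c > 0"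
  shows "integrable lborel (\<lambda>x::'a. complex_of_real (gauss c x))"
    and "fourier (\<lambda>x::'a. complex_of_real (gauss c x)) z = complex_of_real (gauss_kernel c z)"
proof -
  interpret product_sigma_finite "\<lambda>_::'a. lborel :: real measure"
    by (simp add: product_sigma_finite_def sigma_finite_lborel)
  let ?T = "\<lambda>f::'a \<Rightarrow> real. \<Sum>b\<in>Basis. f b *\<^sub>R b"
  let ?h = "\<lambda>z (b::'a) t. complex_of_real (exp (- (c * t)\<^sup>2 / 2)) * cis (- (2 * pi * (t * (z \<bullet> b))))"
  have T[measurable]: "?T \<in> (\<Pi>\<^sub>M b\<in>Basis. lborel) \<rightarrow>\<^sub>M borel"
    by measurable
  have cs: "cis (- (2 * pi * (x \<bullet> z))) = (\<Prod>b\<in>Basis. cis (- (2 * pi * ((x \<bullet> b) * (z \<bullet> b)))))" for x z :: 'a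
  proof -
    have "cis (- (2 * pi * (x \<bullet> z))) = cis (\<Sum>b\<in>Basis. - (2 * pi * ((x \<bullet> b) * (z \<bullet> b))))"
      by (subst euclidean_inner) (simp add: sum_distrib_left sum_negf)
    also have "\<dots> = (\<Prod>b\<in>Basis. cis (- (2 * pi * ((x \<bullet> b) * (z \<bullet> b)))))"
      by (simp add: cis_conv_exp sum_distrib_left flip: exp_sum)
    finally show ?thesis .
  qed
  have pr: "complex_of_real (gauss c x) * cis (- (2 * pi * (x \<bullet> z))) = (\<Prod>b\<in>Basis. ?h z b (x \<bullet> b))" for x z :: 'a
    by (simp add: gauss_prod cs prod.distrib)
  have pr': "(\<Prod>b\<in>Basis. ?h z b (?T f \<bullet> b)) = (\<Prod>b\<in>Basis. ?h z b (f b))" for f z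
    by (intro prod.cong) (auto simp: inner_sum_left inner_Basis if_distrib cong: if_cong)
  have m: "(\<lambda>x::'a. complex_of_real (gauss c x) * cis (- (2 * pi * (x \<bullet> z)))) \<in> borel_measurable borel" for z
    by measurable
  have "integrable (\<Pi>\<^sub>M b\<in>Basis. lborel) (\<lambda>f. \<Prod>b\<in>Basis. ?h z b (f b))" for z
    by (intro product_integrable_prod fourier_gauss_real c) auto
  then have "integrable (distr (\<Pi>\<^sub>M b\<in>Basis. lborel) borel ?T) (\<lambda>x. complex_of_real (gauss c x) * cis (- (2 * pi * (x \<bullet> z))))" for z
    by (subst integrable_distr_eq[OF T m]) (simp add: pr pr')
  \<comment> \<open>At \<open>z = 0\<close> the character is 1.\<close>
  from this[of 0] show "integrable lborel (\<lambda>x::'a. complex_of_real (gauss c x))"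
    by (simp flip: lborel_eq)
  have "(LINT x|lborel. complex_of_real (gauss c x) * cis (- (2 * pi * (x \<bullet> z))))
     = (\<integral>f. (\<Prod>b\<in>Basis. ?h z b (f b)) \<partial>(\<Pi>\<^sub>M b\<in>Basis. lborel))"
    by (subst lborel_eq, subst integral_distr[OF T m]) (simp add: pr pr')
  also have "\<dots> = (\<Prod>b\<in>Basis. LINT t|lborel. ?h z b t)"
    by (intro product_integral_prod fourier_gauss_real c) auto
  also have "\<dots> = (\<Prod>b\<in>Basis. complex_of_real (sqrt (2 * pi) / c * exp (- (2 * pi * (z \<bullet> b) / c)\<^sup>2 / 2)))"
    by (intro prod.cong refl fourier_gauss_real c)
  also have "\<dots> = complex_of_real (gauss_kernel c z)"
    by (simp add: gauss_kernel_def gauss_prod prod.distrib of_real_prod power_divide prod_dividef flip: of_real_power)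
  finally show "fourier (\<lambda>x::'a. complex_of_real (gauss c x)) z = complex_of_real (gauss_kernel c z)"
    by (simp add: fourier_lborel)
qed

lemma integrable_gauss: "c > 0 \<Longrightarrow> integrable lborel (gauss c :: 'a::euclidean_space \<Rightarrow> real)"
  using fourier_gauss(1)[of c] complex_of_real_integrable_eq by blast

lemma integrable_gauss_kernel: "c > 0 \<Longrightarrow> integrable lborel (gauss_kernel c :: 'a::euclidean_space \<Rightarrow> real)"
  unfolding gauss_kernel_def[abs_def] by (intro integrable_mult_right integrable_gauss) auto

text \<open>The integral of a Gaussian is its transform at the origin. Up to its prefactor
  \<open>gauss_kernel c\<close> is \<open>gauss (2 * pi / c)\<close>, so the transform formula is
  used with that parameter.\<close>

lemma nn_integral_gauss_kernel:
  assumes c: "c > 0"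
  shows "(\<integral>\<^sup>+x. ennreal (gauss_kernel c x) \<partial>(lborel :: 'a::euclidean_space measure)) = 1"
proof -
  have c': "2 * pi / c > 0" using c by simp
  have "complex_of_real (LINT x|lborel. gauss (2 * pi / c) (x::'a)) = complex_of_real (gauss_kernel (2 * pi / c) (0::'a))"
    using fourier_gauss(2)[OF c', of "0::'a"] by (simp add: fourier_lborel)
  then have "(LINT x|lborel. gauss (2 * pi / c) (x::'a)) = (sqrt (2 * pi) * c / (2 * pi)) ^ DIM('a)"
    by (simp only: of_real_eq_iff) (simp add: gauss_kernel_def gauss_def)
  then have "(LINT x|lborel. gauss_kernel c (x::'a)) = (sqrt (2 * pi) / c * (sqrt (2 * pi) * c / (2 * pi))) ^ DIM('a)"
    unfolding gauss_kernel_def by (subst integral_mult_right_zero) (simp only: power_mult_distrib)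
  also have "sqrt (2 * pi) / c * (sqrt (2 * pi) * c / (2 * pi)) = 1"
    using c by (simp add: field_simps)
  finally show ?thesis
    by (subst nn_integral_eq_integral) (auto simp: integrable_gauss_kernel c less_imp_le gauss_kernel_pos)
qed

section \<open>The Plancherel inequality\<close>

text \<open>Fatou's lemma in the form in which a uniform bound survives an almost everywhere limit;
  it later removes the Gaussian factors.\<close>

lemma nn_integral_le_of_tendsto:
  fixes g :: "nat \<Rightarrow> 'a \<Rightarrow> ennreal"
  assumes "\<And>n. g n \<in> borel_measurable M" "\<And>n. (\<integral>\<^sup>+x. g n x \<partial>M) \<le> C"
    "AE x in M. (\<lambda>n. g n x) \<longlonglongrightarrow> f x"
  shows "(\<integral>\<^sup>+x. f x \<partial>M) \<le> C"
proof -
  have "(\<integral>\<^sup>+x. f x \<partial>M) = (\<integral>\<^sup>+x. liminf (\<lambda>n. g n x) \<partial>M)"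
  proof (rule nn_integral_cong_AE)
    show "AE x in M. f x = liminf (\<lambda>n. g n x)"
      using assms(3)
    proof eventually_elim
      case (elim x)
      then show ?case
        using lim_imp_Liminf[OF sequentially_bot] by metis
    qed
  qed
  also have "\<dots> \<le> liminf (\<lambda>n. \<integral>\<^sup>+x. g n x \<partial>M)"
    by (rule nn_integral_liminf) (rule assms)
  also have "\<dots> \<le> C"
    by (rule order_trans[OF Liminf_le_Limsup Limsup_bounded]) (auto simp: assms(2))
  finally show ?thesis .
qed

lemma integrable_mult_bounded:
  fixes f g :: "'a \<Rightarrow> complex"
  assumes f: "integrable M f" and g: "g \<in> borel_measurable M" "\<And>x. norm (g x) \<le> B"
  shows "integrable M (\<lambda>x. f x * g x)"
proof (rule Bochner_Integration.integrable_bound)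
  show "integrable M (\<lambda>x. complex_of_real B * f x)" using f by simp
  show "AE x in M. norm (f x * g x) \<le> norm (complex_of_real B * f x)"
  proof (rule AE_I2)
    fix x
    have "norm (g x) \<le> \<bar>B\<bar>"
      using g(2)[of x] by linarith
    from mult_left_mono[OF this norm_ge_zero[of "f x"]]
    show "norm (f x * g x) \<le> norm (complex_of_real B * f x)"
      by (simp add: norm_mult mult.commute)
  qed
qed (use assms in auto)

lemma norm_fourier_le_real:
  fixes f :: "'a::euclidean_space \<Rightarrow> complex"
  assumes "integrable lborel f"
  shows "norm (fourier f \<xi>) \<le> (LINT x|lborel. norm (f x))"
  using norm_fourier_le[OF assms, of \<xi>] assms
  by (subst (asm) nn_integral_eq_integral) (auto simp: ennreal_le_iff)

text \<open>Both sides are iterated integrals of \<open>f x * g y\<close> times a unimodular kernel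
  symmetric in \<open>x\<close> and \<open>y\<close>; Fubini applies because the double integral of
  the modulus is the product of the two L^1 norms.\<close>

lemma multiplication_formula:
  fixes f g :: "'a::euclidean_space \<Rightarrow> complex"
  assumes f: "integrable lborel f" and g: "integrable lborel g"
  shows "(LINT x|lborel. fourier f x * g x) = (LINT x|lborel. f x * fourier g x)"
proof -
  have [measurable]: "f \<in> borel_measurable borel" "g \<in> borel_measurable borel"
    using f g by auto
  let ?k = "\<lambda>(x, y). f x * g y * cis (- (2 * pi * (x \<bullet> y)))"
  have "(\<integral>\<^sup>+z. ennreal (norm (?k z)) \<partial>(lborel \<Otimes>\<^sub>M lborel))
      = (\<integral>\<^sup>+x. (\<integral>\<^sup>+y. ennreal (norm (f x)) * ennreal (norm (g y)) \<partial>lborel) \<partial>lborel)"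
    by (subst lborel.nn_integral_fst[symmetric])
       (measurable, simp add: norm_mult ennreal_mult)
  also have "\<dots> < \<infinity>"
    using f g by (simp add: nn_integral_cmult nn_integral_multc integrable_iff_bounded ennreal_mult_less_top)
  finally have k: "integrable (lborel \<Otimes>\<^sub>M lborel) ?k"
    by (intro integrableI_bounded) measurable
  have "(LINT y|lborel. fourier f y * g y) = (LINT y|lborel. (LINT x|lborel. ?k (x, y)))"
    by (simp add: fourier_lborel mult_ac flip: integral_mult_right_zero)
  also have "\<dots> = (LINT x|lborel. (LINT y|lborel. ?k (x, y)))"
    using lborel_pair.Fubini_integral[of "\<lambda>x y. ?k (x, y)"] k by simp
  also have "\<dots> = (LINT x|lborel. f x * fourier g x)"
    by (simp add: fourier_lborel mult_ac inner_commute flip: integral_mult_right_zero)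
  finally show ?thesis .
qed

lemma integrable_fourier_gauss:
  fixes f :: "'a::euclidean_space \<Rightarrow> complex"
  assumes f: "integrable lborel f" and c: "c > 0"
  shows "integrable lborel (\<lambda>\<xi>. fourier f \<xi> * complex_of_real (gauss c \<xi>))"
proof -
  have [measurable]: "f \<in> borel_measurable borel" using f by auto
  show ?thesis
    using integrable_mult_bounded[OF fourier_gauss(1)[OF c], of "fourier f", OF _ norm_fourier_le_real[OF f]]
    by (simp add: mult.commute)
qed

text \<open>The multiplication formula is applied to \<open>f\<close> and a modulated Gaussian,
  whose transform is a translated kernel. Transforming twice reflects, hence \<open>x + y\<close> in
  the kernel.\<close>

lemma fourier_fourier_gauss:
  fixes f :: "'a::euclidean_space \<Rightarrow> complex"
  assumes f: "integrable lborel f" and c: "c > 0"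
  shows "fourier (\<lambda>\<xi>. fourier f \<xi> * complex_of_real (gauss c \<xi>)) x
    = (LINT y|lborel. f y * complex_of_real (gauss_kernel c (x + y)))"
proof -
  have [measurable]: "f \<in> borel_measurable borel" using f by auto
  let ?g = "\<lambda>\<xi>::'a. complex_of_real (gauss c \<xi>) * cis (- (2 * pi * (\<xi> \<bullet> x)))"
  have g: "integrable lborel ?g"
    by (intro integrable_mult_unit fourier_gauss(1) c) auto
  have "fourier ?g y = fourier (\<lambda>x. complex_of_real (gauss c x)) (x + y)" for y
    by (subst (1 2) fourier_lborel, measurable)
       (simp add: mult.assoc cis_mult inner_add_right algebra_simps)
  then have "fourier ?g y = complex_of_real (gauss_kernel c (x + y))" for y
    by (simp only: fourier_gauss(2)[OF c])
  with multiplication_formula[OF f g] show ?thesis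
    by (simp add: fourier_lborel[of "\<lambda>\<xi>. fourier f \<xi> * complex_of_real (gauss c \<xi>)"] mult_ac)
qed

text \<open>Splitting the square of the modulus as the transform times its conjugate, the
  multiplication formula moves the transform from the first factor to the damped second one. There
  it becomes the conjugate of an average of \<open>h\<close> against a kernel of mass one, and such
  an average pairs with \<open>h\<close> to at most the squared L^2 norm.\<close>

lemma plancherel_gauss:
  fixes h :: "'a::euclidean_space \<Rightarrow> complex"
  assumes h: "integrable lborel h" and c: "c > 0"
  shows "(\<integral>\<^sup>+x. ennreal ((norm (fourier h x))\<^sup>2 * gauss c x) \<partial>lborel)
    \<le> (\<integral>\<^sup>+x. ennreal ((norm (h x))\<^sup>2) \<partial>lborel)"
proof -
  have [measurable]: "h \<in> borel_measurable borel" using h by auto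
  have [measurable]: "(\<lambda>x. cnj (fourier h x)) \<in> borel_measurable borel"
    by (rule measurable_compose[of "fourier h" borel borel cnj])
       (auto intro!: borel_measurable_continuous_onI continuous_intros)
  let ?g = "\<lambda>x. cnj (fourier h x) * complex_of_real (gauss c x)"
  have ig: "integrable lborel ?g"
    using integrable_fourier_gauss[OF h c] integrable_cnj[of lborel "\<lambda>\<xi>. fourier h \<xi> * complex_of_real (gauss c \<xi>)"]
    by simp
  have fg: "fourier ?g \<xi> = cnj (LINT y|lborel. h y * complex_of_real (gauss_kernel c (y - \<xi>)))" for \<xi>
  proof -
    have "fourier ?g \<xi> = (LINT x|lborel. cnj (fourier h x * complex_of_real (gauss c x) * cis (- (2 * pi * (x \<bullet> - \<xi>)))))"
      by (subst fourier_lborel[of ?g], measurable) (simp add: cis_cnj)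
    also have "\<dots> = cnj (fourier (\<lambda>\<xi>. fourier h \<xi> * complex_of_real (gauss c \<xi>)) (- \<xi>))"
      unfolding Bochner_Integration.integral_cnj
      by (subst fourier_lborel[of "\<lambda>\<xi>. fourier h \<xi> * complex_of_real (gauss c \<xi>)"]) simp_all
    finally show ?thesis
      by (simp add: fourier_fourier_gauss[OF h c])
  qed
  have sq: "fourier h x * ?g x = complex_of_real ((norm (fourier h x))\<^sup>2 * gauss c x)" for x
    by (simp only: of_real_mult complex_norm_square mult.assoc)
  have isq: "integrable lborel (\<lambda>x. fourier h x * ?g x)"
    using integrable_mult_bounded[OF ig, of "fourier h", OF _ norm_fourier_le_real[OF h]] by (simp add: mult.commute)
  then have isq': "integrable lborel (\<lambda>x. (norm (fourier h x))\<^sup>2 * gauss c x)"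
    unfolding sq complex_of_real_integrable_eq .
  have bd: "norm (fourier ?g \<xi>) \<le> (LINT x|lborel. norm (?g x))" for \<xi>
    by (rule norm_fourier_le_real[OF ig])
  have igg: "integrable lborel (\<lambda>\<xi>. h \<xi> * fourier ?g \<xi>)"
    by (rule integrable_mult_bounded[OF h _ bd]) simp
  have le: "ennreal (norm (fourier ?g \<xi>)) \<le> (\<integral>\<^sup>+y. ennreal (norm (h y) * gauss_kernel c (y - \<xi>)) \<partial>lborel)" for \<xi>
  \<comment> \<open>A non-integrable function has integral 0 by convention, so the bound is trivial
    in that case.\<close>
  proof (cases "integrable lborel (\<lambda>y. h y * complex_of_real (gauss_kernel c (y - \<xi>)))")
    case True
    from integral_norm_bound_ennreal[OF this] show ?thesis
      by (simp add: fg norm_mult gauss_kernel_pos[OF c] less_imp_le)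
  qed (simp add: fg not_integrable_integral_eq)
  have one: "(\<integral>\<^sup>+y. ennreal (gauss_kernel c (y - \<xi>)) \<partial>lborel) = 1"
    "(\<integral>\<^sup>+y. ennreal (gauss_kernel c (\<xi> - y)) \<partial>lborel) = 1" for \<xi> :: 'a
    using nn_integral_shift(2,3)[of "\<lambda>y. ennreal (gauss_kernel c y)" \<xi>] nn_integral_gauss_kernel[OF c, where 'a='a]
    by simp_all
  let ?N = "\<lambda>x. ennreal ((norm (h x))\<^sup>2)"
  \<comment> \<open>The inequality 2 a b \<le> a^2 + b^2 takes the place of Cauchy-Schwarz: each
    square is afterwards integrated against the kernel in the other variable, where the mass is
    one.\<close>
  have am: "norm (h \<xi>) * (norm (h y) * k) \<le> ((norm (h \<xi>))\<^sup>2 * k + (norm (h y))\<^sup>2 * k) / 2" if "k > 0" for \<xi> y k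
    using mult_right_mono[OF sum_squares_bound[of "norm (h \<xi>)" "norm (h y)"], of k] that
    by (simp add: algebra_simps)
  have "(\<integral>\<^sup>+x. ennreal ((norm (fourier h x))\<^sup>2 * gauss c x) \<partial>lborel)
     = ennreal (LINT x|lborel. (norm (fourier h x))\<^sup>2 * gauss c x)"
    using isq' by (intro nn_integral_eq_integral) (auto simp: gauss_pos less_imp_le)
  also have "\<dots> = ennreal (norm (LINT x|lborel. fourier h x * ?g x))"
    unfolding sq by (subst integral_complex_of_real) (simp add: gauss_pos less_imp_le)
  also have "\<dots> = ennreal (norm (LINT x|lborel. h x * fourier ?g x))"
    by (simp only: multiplication_formula[OF h ig])
  also have "\<dots> \<le> (\<integral>\<^sup>+\<xi>. ennreal (norm (h \<xi>)) * ennreal (norm (fourier ?g \<xi>)) \<partial>lborel)"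
    using integral_norm_bound_ennreal[OF igg] by (simp add: norm_mult ennreal_mult)
  also have "\<dots> \<le> (\<integral>\<^sup>+\<xi>. ennreal (norm (h \<xi>)) * (\<integral>\<^sup>+y. ennreal (norm (h y) * gauss_kernel c (y - \<xi>)) \<partial>lborel) \<partial>lborel)"
    by (intro nn_integral_mono mult_left_mono le) auto
  also have "\<dots> = (\<integral>\<^sup>+\<xi>. (\<integral>\<^sup>+y. ennreal (norm (h \<xi>) * (norm (h y) * gauss_kernel c (y - \<xi>))) \<partial>lborel) \<partial>lborel)"
    by (simp add: nn_integral_cmult ennreal_mult' flip: nn_integral_cmult)
  also have "\<dots> \<le> (\<integral>\<^sup>+\<xi>. (\<integral>\<^sup>+y. (?N \<xi> * ennreal (gauss_kernel c (y - \<xi>)) + ?N y * ennreal (gauss_kernel c (y - \<xi>))) / 2 \<partial>lborel) \<partial>lborel)"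
    using am[OF gauss_kernel_pos[OF c]]
    by (intro nn_integral_mono)
       (simp add: gauss_kernel_pos[OF c] less_imp_le divide_ennreal flip: ennreal_mult ennreal_plus ennreal_numeral)
  also have "\<dots> = ((\<integral>\<^sup>+\<xi>. (\<integral>\<^sup>+y. ?N \<xi> * ennreal (gauss_kernel c (y - \<xi>)) \<partial>lborel) \<partial>lborel)
      + (\<integral>\<^sup>+\<xi>. (\<integral>\<^sup>+y. ?N y * ennreal (gauss_kernel c (y - \<xi>)) \<partial>lborel) \<partial>lborel)) / 2"
    by (simp add: nn_integral_add nn_integral_divide)
  also have "(\<integral>\<^sup>+\<xi>. (\<integral>\<^sup>+y. ?N y * ennreal (gauss_kernel c (y - \<xi>)) \<partial>lborel) \<partial>lborel)
     = (\<integral>\<^sup>+y. (\<integral>\<^sup>+\<xi>. ?N y * ennreal (gauss_kernel c (y - \<xi>)) \<partial>lborel) \<partial>lborel)"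
    by (rule lborel_pair.Fubini') measurable
  finally show ?thesis
    by (simp add: nn_integral_cmult one mult_divide_eq_ennreal flip: mult_2_right)
qed

text \<open>With inverse widths 1 / (n + 1) the Gaussian factors tend to 1 everywhere while the
  bound stays the same.\<close>

lemma plancherel_le:
  fixes h :: "'a::euclidean_space \<Rightarrow> complex"
  assumes h: "integrable lborel h"
  shows "(\<integral>\<^sup>+x. ennreal ((norm (fourier h x))\<^sup>2) \<partial>lborel) \<le> (\<integral>\<^sup>+x. ennreal ((norm (h x))\<^sup>2) \<partial>lborel)"
proof (rule nn_integral_le_of_tendsto)
  have [measurable]: "h \<in> borel_measurable borel" using h by auto
  let ?g = "\<lambda>n x. ennreal ((norm (fourier h x))\<^sup>2 * gauss (1 / real (Suc n)) x)"
  show "?g n \<in> borel_measurable lborel" for n by measurable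
  show "(\<integral>\<^sup>+x. ?g n x \<partial>lborel) \<le> (\<integral>\<^sup>+x. ennreal ((norm (h x))\<^sup>2) \<partial>lborel)" for n
    by (rule plancherel_gauss[OF h]) simp
  have "(\<lambda>n. gauss (1 / real (Suc n)) x) \<longlonglongrightarrow> exp (- (0 * norm x)\<^sup>2 / 2)" for x :: 'a
    unfolding gauss_def by (intro tendsto_intros lim_1_over_n[THEN LIMSEQ_Suc]) auto
  from tendsto_ennrealI[OF tendsto_mult[OF tendsto_const this]]
  show "AE x in lborel. (\<lambda>n. ?g n x) \<longlonglongrightarrow> ennreal ((norm (fourier h x))\<^sup>2)"
    by simp
qed

text \<open>Serves the interpolation twice: with \<open>s = r\<close> as the layer-cake formula, and
  with \<open>s = r - 2\<close> for the integral over the levels at a fixed point.\<close>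

lemma nn_integral_powr_interval:
  fixes s a :: real
  assumes "s > 0" "a \<ge> 0"
  shows "(\<integral>\<^sup>+l. ennreal (l powr (s - 1)) * indicator {0..a} l \<partial>lborel) = ennreal (a powr s / s)"
  using nn_integral_has_integral_lebesgue[OF _ has_integral_powr_from_0[of "s - 1" a]] assms
  by (simp add: mult.commute ennreal_mult' ennreal_indicator)

section \<open>Interpolation\<close>

lemma pred_atMost [measurable (raw)]:
  fixes f g :: "'b \<Rightarrow> real"
  assumes [measurable]: "f \<in> borel_measurable M" "g \<in> borel_measurable M"
  shows "Measurable.pred M (\<lambda>x. f x \<in> {..g x})"
  unfolding atMost_iff by measurable

lemma fourier_add:
  fixes f g :: "'a::euclidean_space \<Rightarrow> complex"
  assumes f: "integrable lborel f" and g: "integrable lborel g"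
  shows "fourier (\<lambda>x. f x + g x) \<xi> = fourier f \<xi> + fourier g \<xi>"
proof -
  have [measurable]: "f \<in> borel_measurable borel" "g \<in> borel_measurable borel"
    using f g by auto
  have "integrable lborel (\<lambda>x. f x * cis (- (2 * pi * (x \<bullet> \<xi>))))"
    "integrable lborel (\<lambda>x. g x * cis (- (2 * pi * (x \<bullet> \<xi>))))"
    by (intro integrable_mult_unit f g; simp)+
  then show ?thesis
    by (simp add: fourier_lborel distrib_right)
qed

text \<open>
  At level \<open>l\<close> split \<open>h\<close> according to whether \<open>|h|\<^sup>p\<^sup>-\<^sup>1 l\<close> exceeds \<open>2 H\<close>. The high part has \<open>L\<^sup>1\<close> norm
  at most \<open>l / 2\<close>, so where the transform of \<open>h\<close> reaches \<open>l\<close> that of the low part reaches \<open>l / 2\<close>, and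
  Chebyshev with Plancherel bounds the measure of this set. The exponents are such that integrating
  in \<open>l\<close> turns \<open>|h|\<^sup>2\<close> back into \<open>|h|\<^sup>p\<close>.
\<close>

lemma hausdorff_young_interpolated:
  fixes h :: "'a::euclidean_space \<Rightarrow> complex"
  assumes h: "integrable lborel h" and r: "r > 2" and H: "H > 0"
    and hH: "(\<integral>\<^sup>+x. ennreal (norm (h x) powr (r / (r - 1))) \<partial>lborel) \<le> ennreal H"
  shows "(\<integral>\<^sup>+x. ennreal (norm (fourier h x) powr r) \<partial>lborel)
    \<le> ennreal (4 * r * 2 powr (r - 2) / (r - 2) * H powr (r - 1))"
proof -
  define p where "p = r / (r - 1)"
  have p: "p > 1" and p1: "p - 1 = 1 / (r - 1)"
    using r by (auto simp: p_def field_simps)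
  have [measurable]: "h \<in> borel_measurable borel" using h by auto
  have level: "(\<integral>\<^sup>+x. indicator {..norm (fourier h x)} l \<partial>lborel)
      \<le> ennreal (4 / l\<^sup>2) * (\<integral>\<^sup>+x. ennreal ((norm (h x))\<^sup>2 * indicator {..2 * H} (norm (h x) powr (p - 1) * l)) \<partial>lborel)"
    if l: "l > 0" for l
  proof -
    define B where "B = {x. norm (h x) powr (p - 1) * l \<le> 2 * H}"
    have B[measurable]: "B \<in> sets borel"
      unfolding B_def by measurable
    let ?low = "\<lambda>x. h x * indicator B x" and ?high = "\<lambda>x. h x * indicator (- B) x"
    have il: "integrable lborel ?low" "integrable lborel ?high"
      by (intro integrable_mult_unit h; simp add: indicator_def)+
    have split: "fourier h x = fourier ?low x + fourier ?high x" for x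
      using fourier_add[OF il, of x]
      by (simp add: indicator_compl algebra_simps)
    \<comment> \<open>Off \<open>B\<close> the factor
      \<open>norm (h x) powr (p - 1) * (l / (2 * H))\<close> exceeds 1, so it may be multiplied onto
      \<open>norm (h x)\<close>; this produces the p-th power, whose integral is at most
      \<open>H\<close>.\<close>
    have hb: "norm (?high x) \<le> norm (h x) powr p * (l / (2 * H))" for x
    proof (cases "x \<in> B")
      case False
      then have *: "norm (h x) powr (p - 1) * l > 2 * H" by (simp add: B_def)
      then have "h x \<noteq> 0" using H p by (intro notI) auto
      then have "norm (h x) powr p = norm (h x) * norm (h x) powr (p - 1)"
        by (simp add: powr_diff)
      moreover have "norm (h x) * 1 \<le> norm (h x) * (norm (h x) powr (p - 1) * (l / (2 * H)))"
        using * H by (intro mult_left_mono) (auto simp: field_simps)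
      ultimately show ?thesis
        using False by (simp only: mult.assoc) simp
    qed (use l H in simp)
    have high: "norm (fourier ?high x) \<le> l / 2" for x
    proof -
      have "ennreal (norm (fourier ?high x)) \<le> (\<integral>\<^sup>+x. ennreal (norm (h x) powr p) * ennreal (l / (2 * H)) \<partial>lborel)"
        using hb l H
        by (intro order_trans[OF norm_fourier_le[OF il(2)]] nn_integral_mono)
           (simp flip: ennreal_mult)
      also have "\<dots> = (\<integral>\<^sup>+x. ennreal (norm (h x) powr p) \<partial>lborel) * ennreal (l / (2 * H))"
        by (rule nn_integral_multc) simp
      also have "\<dots> \<le> ennreal H * ennreal (l / (2 * H))"
        using hH by (intro mult_right_mono) (simp_all add: p_def)
      also have "\<dots> = ennreal (l / 2)"
        using H l by (simp flip: ennreal_mult)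
      finally show ?thesis using l by (simp add: ennreal_le_iff)
    qed
    have pt: "indicator {..norm (fourier h x)} l \<le> ennreal (4 / l\<^sup>2) * ennreal ((norm (fourier ?low x))\<^sup>2)" for x
    proof (cases "l \<le> norm (fourier h x)")
      case True
      have "norm (fourier h x) \<le> norm (fourier ?low x) + norm (fourier ?high x)"
        unfolding split[of x] by (rule norm_triangle_ineq)
      with True high[of x] have "l / 2 \<le> norm (fourier ?low x)" by linarith
      then have "(l / 2)\<^sup>2 \<le> (norm (fourier ?low x))\<^sup>2"
        using l by (intro power_mono) auto
      then have "1 \<le> 4 / l\<^sup>2 * (norm (fourier ?low x))\<^sup>2"
        using l by (simp add: field_simps power2_eq_square)
      then have "1 \<le> ennreal (4 / l\<^sup>2 * (norm (fourier ?low x))\<^sup>2)"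
        by (subst ennreal_1[symmetric], intro ennreal_leI)
      also have "\<dots> = ennreal (4 / l\<^sup>2) * ennreal ((norm (fourier ?low x))\<^sup>2)"
        by (rule ennreal_mult) auto
      finally show ?thesis
        using True by simp
    qed (simp add: indicator_def)
    have "(\<integral>\<^sup>+x. indicator {..norm (fourier h x)} l \<partial>lborel)
      \<le> (\<integral>\<^sup>+x. ennreal (4 / l\<^sup>2) * ennreal ((norm (fourier ?low x))\<^sup>2) \<partial>lborel)"
      by (intro nn_integral_mono pt)
    also have "\<dots> = ennreal (4 / l\<^sup>2) * (\<integral>\<^sup>+x. ennreal ((norm (fourier ?low x))\<^sup>2) \<partial>lborel)"
      by (rule nn_integral_cmult) simp
    also have "\<dots> \<le> ennreal (4 / l\<^sup>2) * (\<integral>\<^sup>+x. ennreal ((norm (?low x))\<^sup>2) \<partial>lborel)"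
      by (intro mult_left_mono plancherel_le il) simp
    also have "(\<lambda>x. (norm (?low x))\<^sup>2) = (\<lambda>x. (norm (h x))\<^sup>2 * indicator {..2 * H} (norm (h x) powr (p - 1) * l))"
      by (auto simp: fun_eq_iff B_def indicator_def)
    finally show ?thesis .
  qed
  \<comment> \<open>The admissible levels at a point with \<open>h x \<noteq> 0\<close> form an
    interval starting at 0. Integrability of \<open>l powr (r - 3)\<close> at 0 is where
    \<open>r > 2\<close> enters, and it costs the factor \<open>1 / (r - 2)\<close>.\<close>
  have inner: "(\<integral>\<^sup>+l. ennreal (l powr (r - 3) * (norm (h x))\<^sup>2) * indicator {l. 0 \<le> l \<and> norm (h x) powr (p - 1) * l \<le> 2 * H} l \<partial>lborel)
      = ennreal (2 powr (r - 2) / (r - 2) * H powr (r - 2)) * ennreal (norm (h x) powr p)" for x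
  proof (cases "h x = 0")
    case False
    define a where "a = norm (h x)"
    have a: "a > 0" using False by (simp add: a_def)
    \<comment> \<open>The length of the interval raised to \<open>r - 2\<close> contains
      \<open>a powr (2 - p)\<close> in the denominator; against \<open>a\<^sup>2\<close> this leaves
      exactly \<open>a powr p\<close>.\<close>
    have e: "(p - 1) * (r - 2) = 2 - p" using r by (simp add: p_def field_simps)
    have "{l. 0 \<le> l \<and> a powr (p - 1) * l \<le> 2 * H} = {0..2 * H / a powr (p - 1)}"
      using a by (auto simp: field_simps)
    then have "(\<integral>\<^sup>+l. ennreal (l powr (r - 3) * a\<^sup>2) * indicator {l. 0 \<le> l \<and> a powr (p - 1) * l \<le> 2 * H} l \<partial>lborel)
      = (\<integral>\<^sup>+l. ennreal (a\<^sup>2) * (ennreal (l powr (r - 2 - 1)) * indicator {0..2 * H / a powr (p - 1)} l) \<partial>lborel)"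
      by (simp add: ennreal_mult mult_ac)
    also have "\<dots> = ennreal (a\<^sup>2) * ennreal ((2 * H / a powr (p - 1)) powr (r - 2) / (r - 2))"
      using r H a nn_integral_powr_interval[of "r - 2" "2 * H / a powr (p - 1)"]
      by (subst nn_integral_cmult) auto
    also have "\<dots> = ennreal (a\<^sup>2 * ((2 * H / a powr (p - 1)) powr (r - 2) / (r - 2)))"
      using r by (subst ennreal_mult[symmetric]) auto
    also have "(2 * H / a powr (p - 1)) powr (r - 2) = 2 powr (r - 2) * H powr (r - 2) / a powr (2 - p)"
      using H a by (simp add: powr_divide powr_mult powr_powr e)
    also have "a\<^sup>2 * (2 powr (r - 2) * H powr (r - 2) / a powr (2 - p) / (r - 2))
       = 2 powr (r - 2) / (r - 2) * H powr (r - 2) * a powr p"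
    proof -
      have "a\<^sup>2 = a powr p * a powr (2 - p)"
        using a by (simp flip: powr_add)
      then show ?thesis
        using a by simp
    qed
    also have "ennreal (2 powr (r - 2) / (r - 2) * H powr (r - 2) * a powr p)
       = ennreal (2 powr (r - 2) / (r - 2) * H powr (r - 2)) * ennreal (a powr p)"
      using r by (intro ennreal_mult) auto
    finally show ?thesis
      unfolding a_def .
  qed (use p in simp)
  let ?X = "\<integral>\<^sup>+x. (\<integral>\<^sup>+l. ennreal (l powr (r - 1)) * indicator {0..} l * indicator {..norm (fourier h x)} l \<partial>lborel) \<partial>lborel"
  have "(\<integral>\<^sup>+x. ennreal (norm (fourier h x) powr r) \<partial>lborel)
     = (\<integral>\<^sup>+x. ennreal r * (\<integral>\<^sup>+l. ennreal (l powr (r - 1)) * indicator {0..norm (fourier h x)} l \<partial>lborel) \<partial>lborel)"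
    using r by (simp add: nn_integral_powr_interval flip: ennreal_mult)
  also have "\<dots> = ennreal r * ?X"
  proof -
    have "indicator {0..b} l = indicator {0..} l * (indicator {..b} l :: ennreal)" for b l :: real
      by (simp add: indicator_def)
    then have "(\<integral>\<^sup>+x. ennreal r * (\<integral>\<^sup>+l. ennreal (l powr (r - 1)) * indicator {0..norm (fourier h x)} l \<partial>lborel) \<partial>lborel)
      = (\<integral>\<^sup>+x. ennreal r * (\<integral>\<^sup>+l. ennreal (l powr (r - 1)) * indicator {0..} l * indicator {..norm (fourier h x)} l \<partial>lborel) \<partial>lborel)"
      by (simp only: mult.assoc)
    also have "\<dots> = ennreal r * (\<integral>\<^sup>+x. (\<integral>\<^sup>+l. ennreal (l powr (r - 1)) * indicator {0..} l * indicator {..norm (fourier h x)} l \<partial>lborel) \<partial>lborel)"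
      by (rule nn_integral_cmult) measurable
    finally show ?thesis .
  qed
  finally have LX: "(\<integral>\<^sup>+x. ennreal (norm (fourier h x) powr r) \<partial>lborel) = ennreal r * ?X" .
  have "?X = (\<integral>\<^sup>+l. (\<integral>\<^sup>+x. ennreal (l powr (r - 1)) * indicator {0..} l * indicator {..norm (fourier h x)} l \<partial>lborel) \<partial>lborel)"
    by (rule lborel_pair.Fubini') measurable
  also have "\<dots> = (\<integral>\<^sup>+l. ennreal (l powr (r - 1)) * indicator {0..} l * (\<integral>\<^sup>+x. indicator {..norm (fourier h x)} l \<partial>lborel) \<partial>lborel)"
    by (subst nn_integral_cmult) auto
  also have "\<dots> \<le> (\<integral>\<^sup>+l. (\<integral>\<^sup>+x. ennreal 4 * (ennreal (l powr (r - 3) * (norm (h x))\<^sup>2) * indicator {l. 0 \<le> l \<and> norm (h x) powr (p - 1) * l \<le> 2 * H} l) \<partial>lborel) \<partial>lborel)"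
  proof (intro nn_integral_mono)
    fix l :: real
    show "ennreal (l powr (r - 1)) * indicator {0..} l * (\<integral>\<^sup>+x. indicator {..norm (fourier h x)} l \<partial>lborel)
      \<le> (\<integral>\<^sup>+x. ennreal 4 * (ennreal (l powr (r - 3) * (norm (h x))\<^sup>2) * indicator {l. 0 \<le> l \<and> norm (h x) powr (p - 1) * l \<le> 2 * H} l) \<partial>lborel)"
    proof (cases "l > 0")
      case True
      \<comment> \<open>The power \<open>r - 1\<close> comes from the layer-cake formula and
        \<open>4 / l\<^sup>2\<close> from Chebyshev's inequality at height
        \<open>l / 2\<close>.\<close>
      have e: "l powr (r - 1) * (4 / l\<^sup>2) = 4 * l powr (r - 3)"
      proof -
        have "l powr (r - 1) = l powr (r - 3) * l\<^sup>2"
          using True by (simp flip: powr_add powr_numeral)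
        then show ?thesis
          using True by simp
      qed
      have e': "ennreal (l powr (r - 1)) * ennreal (4 / l\<^sup>2) = ennreal (4 * l powr (r - 3))"
        by (subst e[symmetric], rule ennreal_mult[symmetric]) auto
      have "ennreal (l powr (r - 1)) * indicator {0..} l * (\<integral>\<^sup>+x. indicator {..norm (fourier h x)} l \<partial>lborel)
        \<le> ennreal (l powr (r - 1)) * (ennreal (4 / l\<^sup>2) * (\<integral>\<^sup>+x. ennreal ((norm (h x))\<^sup>2 * indicator {..2 * H} (norm (h x) powr (p - 1) * l)) \<partial>lborel))"
        using level[OF True] True by (simp add: mult_left_mono)
      also have "\<dots> = ennreal (4 * l powr (r - 3)) * (\<integral>\<^sup>+x. ennreal ((norm (h x))\<^sup>2 * indicator {..2 * H} (norm (h x) powr (p - 1) * l)) \<partial>lborel)"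
        by (simp only: e' flip: mult.assoc)
      also have "\<dots> = (\<integral>\<^sup>+x. ennreal (4 * l powr (r - 3)) * ennreal ((norm (h x))\<^sup>2 * indicator {..2 * H} (norm (h x) powr (p - 1) * l)) \<partial>lborel)"
        by (rule nn_integral_cmult[symmetric]) measurable
      also have "\<dots> = (\<integral>\<^sup>+x. ennreal 4 * (ennreal (l powr (r - 3) * (norm (h x))\<^sup>2) * indicator {l. 0 \<le> l \<and> norm (h x) powr (p - 1) * l \<le> 2 * H} l) \<partial>lborel)"
      proof (rule nn_integral_cong)
        fix x
        show "ennreal (4 * l powr (r - 3)) * ennreal ((norm (h x))\<^sup>2 * indicator {..2 * H} (norm (h x) powr (p - 1) * l))
          = ennreal 4 * (ennreal (l powr (r - 3) * (norm (h x))\<^sup>2) * indicator {l. 0 \<le> l \<and> norm (h x) powr (p - 1) * l \<le> 2 * H} l)"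
          using True by (cases "norm (h x) powr (p - 1) * l \<le> 2 * H") (simp_all add: ennreal_mult mult.assoc)
      qed
      finally show ?thesis .
    next
      case False
      \<comment> \<open>For negative \<open>l\<close> the indicator vanishes, and at
        \<open>l = 0\<close> the power does, since \<open>0 powr a\<close> is 0.\<close>
      then have "ennreal (l powr (r - 1)) * indicator {0..} l = 0"
        by (cases "l = 0") (auto simp: indicator_def)
      then show ?thesis by (simp only: mult_zero_left zero_le)
    qed
  qed
  also have "\<dots> = (\<integral>\<^sup>+x. (\<integral>\<^sup>+l. ennreal 4 * (ennreal (l powr (r - 3) * (norm (h x))\<^sup>2) * indicator {l. 0 \<le> l \<and> norm (h x) powr (p - 1) * l \<le> 2 * H} l) \<partial>lborel) \<partial>lborel)"
    by (rule lborel_pair.Fubini') measurable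
  also have "\<dots> = (\<integral>\<^sup>+x. ennreal 4 * (ennreal (2 powr (r - 2) / (r - 2) * H powr (r - 2)) * ennreal (norm (h x) powr p)) \<partial>lborel)"
    by (subst nn_integral_cmult) (measurable, simp only: inner)
  also have "\<dots> \<le> ennreal 4 * (ennreal (2 powr (r - 2) / (r - 2) * H powr (r - 2)) * ennreal H)"
    using hH by (simp add: nn_integral_cmult p_def mult_left_mono)
  finally have "?X \<le> ennreal 4 * (ennreal (2 powr (r - 2) / (r - 2) * H powr (r - 2)) * ennreal H)" .
  then have "(\<integral>\<^sup>+x. ennreal (norm (fourier h x) powr r) \<partial>lborel)
      \<le> ennreal r * (ennreal 4 * (ennreal (2 powr (r - 2) / (r - 2) * H powr (r - 2)) * ennreal H))"
    unfolding LX by (rule mult_left_mono) simp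
  also have "\<dots> = ennreal (r * (4 * (2 powr (r - 2) / (r - 2) * H powr (r - 2) * H)))"
  proof -
    have "0 \<le> 2 powr (r - 2) / (r - 2) * H powr (r - 2)" "0 \<le> r" "0 \<le> H"
      using r H by auto
    then show ?thesis
      by (simp only: ennreal_mult[symmetric] mult_nonneg_nonneg zero_le_numeral)
  qed
  also have "r * (4 * (2 powr (r - 2) / (r - 2) * H powr (r - 2) * H))
      = 4 * r * 2 powr (r - 2) / (r - 2) * H powr (r - 1)"
    using H powr_add[of H "r - 2" 1] by simp
  finally show ?thesis .
qed

section \<open>Continuity of translations in the mean\<close>

text \<open>The sequential form fits dominated convergence, and extended nonnegative integrals keep
  integrability out of the definition.\<close>

definition L1_translation_continuous :: "('a::euclidean_space \<Rightarrow> complex) \<Rightarrow> bool" where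
  "L1_translation_continuous u \<longleftrightarrow> (\<forall>z. z \<longlonglongrightarrow> 0 \<longrightarrow>
     (\<lambda>n::nat. \<integral>\<^sup>+x. ennreal (norm (u (x + z n) - u x)) \<partial>lborel) \<longlonglongrightarrow> 0)"

lemma ennreal_norm_triangle: "ennreal (norm (a + b)) \<le> ennreal (norm a) + ennreal (norm b)"
  using ennreal_leI[OF norm_triangle_ineq[of a b]] by simp

lemma ennreal_norm_triangle_diff:
  "ennreal (norm (a - c)) \<le> ennreal (norm (a - b)) + ennreal (norm (b - c))"
  using ennreal_norm_triangle[of "a - b" "b - c"] by simp

text \<open>A three-epsilon argument: translation preserves the L^1 distance of \<open>u\<close> and
  \<open>v\<close>, so both outer errors equal it and only the translation error of \<open>v\<close>
  depends on the shift.\<close>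

lemma L1_translation_continuous_approx:
  fixes u :: "'a::euclidean_space \<Rightarrow> complex"
  assumes [measurable]: "u \<in> borel_measurable borel"
    and approx: "\<And>e::real. e > 0 \<Longrightarrow> \<exists>v\<in>borel_measurable borel.
      L1_translation_continuous v \<and> (\<integral>\<^sup>+x. ennreal (norm (u x - v x)) \<partial>lborel) \<le> ennreal e"
  shows "L1_translation_continuous u"
  unfolding L1_translation_continuous_def
proof (intro allI impI)
  fix z :: "nat \<Rightarrow> 'a" assume z: "z \<longlonglongrightarrow> 0"
  show "(\<lambda>n. \<integral>\<^sup>+x. ennreal (norm (u (x + z n) - u x)) \<partial>lborel) \<longlonglongrightarrow> 0"
  proof (rule order_tendstoI)
    fix a :: ennreal assume "0 < a"
    \<comment> \<open>The given \<open>a\<close> may be infinite; an intermediate value is finite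
      and yields a real number to be cut into three.\<close>
    then obtain b' where b': "0 < b'" "b' < a"
      using dense by blast
    define b where "b = enn2real b'"
    have b: "b > 0" "ennreal b < a"
      using b' by (auto simp: b_def enn2real_positive_iff less_top order.strict_trans2[OF _ top_greatest])
    define e where "e = b / 3"
    have e: "e > 0" using b by (simp add: e_def)
    obtain v where [measurable]: "v \<in> borel_measurable borel" and v: "L1_translation_continuous v"
      and uv: "(\<integral>\<^sup>+x. ennreal (norm (u x - v x)) \<partial>lborel) \<le> ennreal e"
      using approx[OF e] by blast
    have "eventually (\<lambda>n. (\<integral>\<^sup>+x. ennreal (norm (v (x + z n) - v x)) \<partial>lborel) < ennreal e) sequentially"
      using v z e unfolding L1_translation_continuous_def by (intro order_tendstoD(2)[where y=0]) auto
    then show "eventually (\<lambda>n. (\<integral>\<^sup>+x. ennreal (norm (u (x + z n) - u x)) \<partial>lborel) < a) sequentially"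
    proof eventually_elim
      case (elim n)
      have "(\<integral>\<^sup>+x. ennreal (norm (u (x + z n) - u x)) \<partial>lborel)
         \<le> (\<integral>\<^sup>+x. ennreal (norm (u (x + z n) - v (x + z n)))
              + (ennreal (norm (v (x + z n) - v x)) + ennreal (norm (u x - v x))) \<partial>lborel)"
      proof (rule nn_integral_mono)
        fix x
        show "ennreal (norm (u (x + z n) - u x)) \<le> ennreal (norm (u (x + z n) - v (x + z n)))
              + (ennreal (norm (v (x + z n) - v x)) + ennreal (norm (u x - v x)))"
          using order_trans[OF ennreal_norm_triangle_diff[of "u (x + z n)" "u x" "v (x + z n)"]
            add_left_mono[OF ennreal_norm_triangle_diff[of "v (x + z n)" "u x" "v x"]]]
          by (simp add: norm_minus_commute[of "u x"])
      qed
      also have "\<dots> = (\<integral>\<^sup>+x. ennreal (norm (u (x + z n) - v (x + z n))) \<partial>lborel)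
         + ((\<integral>\<^sup>+x. ennreal (norm (v (x + z n) - v x)) \<partial>lborel) + (\<integral>\<^sup>+x. ennreal (norm (u x - v x)) \<partial>lborel))"
        by (simp add: nn_integral_add)
      also have "(\<integral>\<^sup>+x. ennreal (norm (u (x + z n) - v (x + z n))) \<partial>lborel) = (\<integral>\<^sup>+x. ennreal (norm (u x - v x)) \<partial>lborel)"
        using nn_integral_shift(1)[of "\<lambda>x. ennreal (norm (u x - v x))" "z n"] by (simp add: add.commute)
      also have "\<dots> + ((\<integral>\<^sup>+x. ennreal (norm (v (x + z n) - v x)) \<partial>lborel) + \<dots>) \<le> ennreal e + (ennreal e + ennreal e)"
        using uv elim by (intro add_mono) auto
      also have "\<dots> = ennreal b"
        using e by (simp add: e_def flip: ennreal_plus)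
      finally show ?case using b by simp
    qed
  qed simp
qed

text \<open>The modulus of the difference of two indicators is their sum minus twice their product.
  The sum has constant integral by translation invariance. Openness makes the product converge
  pointwise: a point of \<open>U\<close> stays in \<open>U\<close> under small shifts.\<close>

lemma L1_translation_continuous_open:
  fixes U :: "'a::euclidean_space set"
  assumes U: "open U" "emeasure lborel U < \<infinity>"
  shows "L1_translation_continuous (\<lambda>x. indicator U x *\<^sub>R c)"
  unfolding L1_translation_continuous_def
proof (intro allI impI)
  fix z :: "nat \<Rightarrow> 'a" assume z: "z \<longlonglongrightarrow> 0"
  have [measurable]: "U \<in> sets borel" using U by auto
  let ?I = "indicat_real U"
  have iU: "integrable lborel ?I"
    using U by (simp add: integrable_indicator_iff)
  have emz: "(\<integral>\<^sup>+x. ennreal (?I (x + a)) \<partial>lborel) = emeasure lborel U" for a :: 'a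
    using nn_integral_shift(1)[of "\<lambda>x. ennreal (?I x)" a] by (simp add: add.commute ennreal_indicator)
  have iz: "integrable lborel (\<lambda>x. ?I (x + a))" for a
    using U(2) by (intro integrableI_nonneg) (auto simp: emz)
  have Iz: "(LINT x|lborel. ?I (x + a)) = measure lborel U" for a
    by (subst integral_eq_nn_integral) (auto simp: emz measure_def)
  have im: "integrable lborel (\<lambda>x. ?I (x + a) * ?I x)" for a
    by (rule Bochner_Integration.integrable_bound[OF iU]) (auto simp: indicator_def)
  have "(\<lambda>n. LINT x|lborel. ?I (x + z n) * ?I x) \<longlonglongrightarrow> (LINT x|lborel. ?I x)"
  proof (rule integral_dominated_convergence[where w="?I"])
    show "AE x in lborel. (\<lambda>n. ?I (x + z n) * ?I x) \<longlonglongrightarrow> ?I x"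
    proof (rule AE_I2)
      fix x :: 'a
      show "(\<lambda>n. ?I (x + z n) * ?I x) \<longlonglongrightarrow> ?I x"
      proof (cases "x \<in> U")
        case True
        have "(\<lambda>n. x + z n) \<longlonglongrightarrow> x + 0" by (intro tendsto_intros z)
        then have "eventually (\<lambda>n. x + z n \<in> U) sequentially"
          using topological_tendstoD[of _ "x + 0" _ U] U True by auto
        then have "eventually (\<lambda>n. ?I (x + z n) * ?I x = ?I x) sequentially"
          by eventually_elim simp
        then show ?thesis by (rule tendsto_eventually)
      qed simp
    qed
  qed (auto simp: iU indicator_def)
  then have lim: "(\<lambda>n. LINT x|lborel. ?I (x + z n) * ?I x) \<longlonglongrightarrow> measure lborel U"
    by simp
  have eq: "(\<integral>\<^sup>+x. ennreal (norm (?I (x + z n) *\<^sub>R c - ?I x *\<^sub>R c)) \<partial>lborel)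
     = ennreal (norm c * (2 * measure lborel U - 2 * (LINT x|lborel. ?I (x + z n) * ?I x)))" for n
  proof -
    have "norm (?I (x + z n) *\<^sub>R c - ?I x *\<^sub>R c) = norm c * (?I (x + z n) + ?I x - 2 * (?I (x + z n) * ?I x))" for x
      by (auto simp: indicator_def)
    moreover have "0 \<le> norm c * (?I (x + z n) + ?I x - 2 * (?I (x + z n) * ?I x))" for x
      by (auto simp: indicator_def)
    moreover have "integrable lborel (\<lambda>x. norm c * (?I (x + z n) + ?I x - 2 * (?I (x + z n) * ?I x)))"
      by (intro integrable_mult_right Bochner_Integration.integrable_diff Bochner_Integration.integrable_add iz iU im)
    ultimately have "(\<integral>\<^sup>+x. ennreal (norm (?I (x + z n) *\<^sub>R c - ?I x *\<^sub>R c)) \<partial>lborel)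
      = ennreal (LINT x|lborel. norm c * (?I (x + z n) + ?I x - 2 * (?I (x + z n) * ?I x)))"
      by (subst nn_integral_eq_integral[symmetric]) auto
    then show ?thesis
      using iz iU im Iz by (simp add: integral_diff integral_add)
  qed
  have "(\<lambda>n. ennreal (norm c * (2 * measure lborel U - 2 * (LINT x|lborel. ?I (x + z n) * ?I x))))
     \<longlonglongrightarrow> ennreal (norm c * (2 * measure lborel U - 2 * measure lborel U))"
    by (intro tendsto_ennrealI tendsto_intros lim)
  then show "(\<lambda>n. \<integral>\<^sup>+x. ennreal (norm (?I (x + z n) *\<^sub>R c - ?I x *\<^sub>R c)) \<partial>lborel) \<longlonglongrightarrow> 0"
    unfolding eq by simp
qed

text \<open>The property passes from open sets to sets of finite measure by outer regularity, then
  to sums by the triangle inequality and to dominated limits by L^1 approximation.\<close>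

lemma integrable_L1_translation_continuous:
  fixes u :: "'a::euclidean_space \<Rightarrow> complex"
  assumes "integrable lborel u"
  shows "L1_translation_continuous u"
  using assms
proof (induction u rule: integrable_induct)
  case (base A c)
  have A[measurable]: "A \<in> sets borel" using base by simp
  show ?case
  proof (rule L1_translation_continuous_approx)
    fix e :: real assume e: "e > 0"
    \<comment> \<open>The summand 1 keeps the quotient meaningful for \<open>c = 0\<close>.\<close>
    define d where "d = e / (1 + norm c)"
    have d: "d > 0" using e by (simp add: d_def add_pos_nonneg)
    obtain U where U: "open U" "A \<subseteq> U" "emeasure lborel (U - A) < d"
      using outer_regular_lborel[OF A d] by blast
    have [measurable]: "U \<in> sets borel" using U by auto
    have "emeasure lborel U = emeasure lborel A + emeasure lborel (U - A)"
      using U(2) by (subst plus_emeasure) (simp_all add: Un_absorb1)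
    also have "\<dots> < \<infinity>"
      using base(2) U(3) by (auto simp: less_top[symmetric])
    finally have fin: "emeasure lborel U < \<infinity>" .
    have "(\<integral>\<^sup>+x. ennreal (norm (indicat_real A x *\<^sub>R c - indicat_real U x *\<^sub>R c)) \<partial>lborel)
      = (\<integral>\<^sup>+x. ennreal (norm c) * indicator (U - A) x \<partial>lborel)"
      using U(2) by (intro nn_integral_cong) (auto simp: indicator_def)
    also have "\<dots> = ennreal (norm c) * emeasure lborel (U - A)"
      by (simp add: nn_integral_cmult_indicator)
    also have "\<dots> \<le> ennreal (norm c) * ennreal d"
      using U(3) by (intro mult_left_mono) auto
    also have "\<dots> \<le> ennreal e"
    proof -
      have "norm c * d \<le> e"
        using e by (simp add: d_def field_simps add_pos_nonneg)
      then show ?thesis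
        using d by (subst ennreal_mult[symmetric]) (auto intro: ennreal_leI)
    qed
    finally show "\<exists>v\<in>borel_measurable borel. L1_translation_continuous v \<and>
        (\<integral>\<^sup>+x. ennreal (norm (indicat_real A x *\<^sub>R c - v x)) \<partial>lborel) \<le> ennreal e"
      by (intro bexI[of _ "\<lambda>x. indicat_real U x *\<^sub>R c"] conjI L1_translation_continuous_open[OF U(1) fin]) measurable
  qed measurable
next
  case (add f g)
  have [measurable]: "f \<in> borel_measurable borel" "g \<in> borel_measurable borel"
    using add by auto
  show ?case
    unfolding L1_translation_continuous_def
  proof (intro allI impI)
    fix z :: "nat \<Rightarrow> 'a" assume z: "z \<longlonglongrightarrow> 0"
    let ?w = "\<lambda>u n. \<integral>\<^sup>+x. ennreal (norm (u (x + z n) - u x)) \<partial>lborel"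
    have "(\<lambda>n. ?w f n + ?w g n) \<longlonglongrightarrow> 0 + 0"
      by (intro tendsto_add add.IH[unfolded L1_translation_continuous_def, rule_format] z)
    moreover have "?w (\<lambda>x. f x + g x) n \<le> ?w f n + ?w g n" for n
    proof -
      have "?w (\<lambda>x. f x + g x) n \<le> (\<integral>\<^sup>+x. ennreal (norm (f (x + z n) - f x)) + ennreal (norm (g (x + z n) - g x)) \<partial>lborel)"
      proof (rule nn_integral_mono)
        fix x
        show "ennreal (norm (f (x + z n) + g (x + z n) - (f x + g x)))
          \<le> ennreal (norm (f (x + z n) - f x)) + ennreal (norm (g (x + z n) - g x))"
          using ennreal_norm_triangle[of "f (x + z n) - f x" "g (x + z n) - g x"]
          by (simp only: add_diff_add)
      qed
      also have "\<dots> = ?w f n + ?w g n"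
        by (rule nn_integral_add) measurable
      finally show ?thesis .
    qed
    ultimately show "?w (\<lambda>x. f x + g x) \<longlonglongrightarrow> 0"
      by (intro tendsto_sandwich[OF _ _ tendsto_const[of 0] \<open>(\<lambda>n. ?w f n + ?w g n) \<longlonglongrightarrow> 0 + 0\<close>[simplified]]
          always_eventually allI) simp_all
  qed
next
  case (lim f s)
  have [measurable]: "f \<in> borel_measurable borel" "\<And>i. s i \<in> borel_measurable borel"
    using lim by auto
  show ?case
  proof (rule L1_translation_continuous_approx)
    fix e :: real assume e: "e > 0"
    have "(\<lambda>i. \<integral>\<^sup>+x. ennreal (norm (f x - s i x)) \<partial>lborel) \<longlonglongrightarrow> 0"
    proof (rule nn_integral_dominated_convergence_norm[where w="\<lambda>x. 2 * norm (f x)"])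
      show "AE x in lborel. norm (s i x) \<le> 2 * norm (f x)" for i
        using lim.hyps(3) by simp
      show "AE x in lborel. (\<lambda>i. s i x) \<longlonglongrightarrow> f x"
        using lim.hyps(2) by simp
      show "(\<integral>\<^sup>+x. ennreal (2 * norm (f x)) \<partial>lborel) < \<infinity>"
        using lim.hyps(4) by (simp add: ennreal_mult nn_integral_cmult integrable_iff_bounded ennreal_mult_less_top)
    qed measurable
    then have "eventually (\<lambda>i. (\<integral>\<^sup>+x. ennreal (norm (f x - s i x)) \<partial>lborel) < ennreal e) sequentially"
      using e by (intro order_tendstoD(2)) auto
    then obtain i where "(\<integral>\<^sup>+x. ennreal (norm (f x - s i x)) \<partial>lborel) < ennreal e"
      by (auto simp: eventually_sequentially)
    then show "\<exists>v\<in>borel_measurable borel. L1_translation_continuous v \<and>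
        (\<integral>\<^sup>+x. ennreal (norm (f x - v x)) \<partial>lborel) \<le> ennreal e"
      using lim.IH[of i] by (intro bexI[of _ "s i"] conjI less_imp_le) simp_all
  qed measurable
qed

section \<open>Inversion along Gaussian means\<close>

lemma gauss_kernel_scale:
  fixes w :: "'a::euclidean_space"
  assumes "c > 0"
  shows "c ^ DIM('a) * gauss_kernel c (c *\<^sub>R w) = gauss_kernel 1 w"
  using assms by (simp add: gauss_kernel_def gauss_def power_divide field_simps)

text \<open>Since the kernel has mass one, the error at \<open>x\<close> is an average of
  \<open>u y - u x\<close>. The substitution \<open>y = x + c *\<^sub>R w\<close> turns the kernel
  into a fixed one, and Tonelli leaves an average of L^1 translation errors. The argument
  \<open>- x\<close> undoes the reflection caused by transforming twice.\<close>

lemma fourier_gauss_L1_error: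
  fixes u :: "'a::euclidean_space \<Rightarrow> complex"
  assumes u: "integrable lborel u" and c: "c > 0"
  shows "(\<integral>\<^sup>+x. ennreal (norm (fourier (\<lambda>\<xi>. fourier u \<xi> * complex_of_real (gauss c \<xi>)) (- x) - u x)) \<partial>lborel)
    \<le> (\<integral>\<^sup>+w. ennreal (gauss_kernel 1 w) * (\<integral>\<^sup>+x. ennreal (norm (u (x + c *\<^sub>R w) - u x)) \<partial>lborel) \<partial>lborel)"
proof -
  have [measurable]: "u \<in> borel_measurable borel" using u by auto
  let ?k = "gauss_kernel c :: 'a \<Rightarrow> real"
  have k0: "0 \<le> ?k y" for y using gauss_kernel_pos[OF c, of y] by simp
  have kb: "norm (complex_of_real (?k y)) \<le> (sqrt (2 * pi) / c) ^ DIM('a)" for y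
  proof -
    have "?k y \<le> (sqrt (2 * pi) / c) ^ DIM('a)"
      unfolding gauss_kernel_def using c by (intro mult_left_le gauss_le_1) simp
    then show ?thesis
      unfolding norm_of_real using k0[of y] by simp
  qed
  have mass: "(\<integral>\<^sup>+y. ennreal (?k (y - x)) \<partial>lborel) = 1" for x
    using nn_integral_shift(2)[of "\<lambda>y. ennreal (?k y)" x] nn_integral_gauss_kernel[OF c, where 'a='a]
    by simp
  have ik: "integrable lborel (\<lambda>y. ?k (y - x))" for x
    using k0 mass by (intro integrableI_nonneg) auto
  have Ik: "(LINT y|lborel. ?k (y - x)) = 1" for x
    using k0 mass by (subst integral_eq_nn_integral) auto
  have iuk: "integrable lborel (\<lambda>y. u y * complex_of_real (?k (y - x)))" for x
    by (rule integrable_mult_bounded[OF u _ kb]) measurable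
  have icx: "integrable lborel (\<lambda>y. u x * complex_of_real (?k (y - x)))" for x
    using ik by (intro integrable_mult_right) (simp add: complex_of_real_integrable_eq)
  have pt: "ennreal (norm (fourier (\<lambda>\<xi>. fourier u \<xi> * complex_of_real (gauss c \<xi>)) (- x) - u x))
      \<le> (\<integral>\<^sup>+y. ennreal (norm (u y - u x)) * ennreal (?k (y - x)) \<partial>lborel)" for x
  proof -
    have "fourier (\<lambda>\<xi>. fourier u \<xi> * complex_of_real (gauss c \<xi>)) (- x) - u x
      = (LINT y|lborel. u y * complex_of_real (?k (y - x))) - (LINT y|lborel. u x * complex_of_real (?k (y - x)))"
      by (simp add: fourier_fourier_gauss[OF u c] Ik)
    also have "\<dots> = (LINT y|lborel. (u y - u x) * complex_of_real (?k (y - x)))"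
      by (subst Bochner_Integration.integral_diff[symmetric]) (simp_all add: iuk icx left_diff_distrib)
    finally have "ennreal (norm (fourier (\<lambda>\<xi>. fourier u \<xi> * complex_of_real (gauss c \<xi>)) (- x) - u x))
      \<le> (\<integral>\<^sup>+y. ennreal (norm ((u y - u x) * complex_of_real (?k (y - x)))) \<partial>lborel)"
      using iuk icx by (simp only: left_diff_distrib integral_norm_bound_ennreal Bochner_Integration.integrable_diff)
    then show ?thesis
      using k0 by (simp add: norm_mult ennreal_mult)
  qed
  have "(\<integral>\<^sup>+x. ennreal (norm (fourier (\<lambda>\<xi>. fourier u \<xi> * complex_of_real (gauss c \<xi>)) (- x) - u x)) \<partial>lborel)
    \<le> (\<integral>\<^sup>+x. (\<integral>\<^sup>+y. ennreal (norm (u y - u x)) * ennreal (?k (y - x)) \<partial>lborel) \<partial>lborel)"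
    by (intro nn_integral_mono pt)
  also have "\<dots> = (\<integral>\<^sup>+x. (\<integral>\<^sup>+w. ennreal (norm (u (x + c *\<^sub>R w) - u x)) * ennreal (gauss_kernel 1 w) \<partial>lborel) \<partial>lborel)"
  proof (rule nn_integral_cong)
    fix x
    have "(\<integral>\<^sup>+y. ennreal (norm (u y - u x)) * ennreal (?k (y - x)) \<partial>lborel)
      = ennreal (c ^ DIM('a)) * (\<integral>\<^sup>+w. ennreal (norm (u (x + c *\<^sub>R w) - u x)) * ennreal (?k (c *\<^sub>R w)) \<partial>lborel)"
      using nn_integral_affine_euclidean[of "\<lambda>y. ennreal (norm (u y - u x)) * ennreal (?k (y - x))" c x] c
      by (simp add: ennreal_power)
    also have "\<dots> = (\<integral>\<^sup>+w. ennreal (c ^ DIM('a)) * (ennreal (norm (u (x + c *\<^sub>R w) - u x)) * ennreal (?k (c *\<^sub>R w))) \<partial>lborel)"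
      by (rule nn_integral_cmult[symmetric]) measurable
    also have "\<dots> = (\<integral>\<^sup>+w. ennreal (norm (u (x + c *\<^sub>R w) - u x)) * ennreal (gauss_kernel 1 w) \<partial>lborel)"
      using c k0 by (simp add: mult.left_commute flip: gauss_kernel_scale[OF c] ennreal_mult)
    finally show "(\<integral>\<^sup>+y. ennreal (norm (u y - u x)) * ennreal (?k (y - x)) \<partial>lborel)
      = (\<integral>\<^sup>+w. ennreal (norm (u (x + c *\<^sub>R w) - u x)) * ennreal (gauss_kernel 1 w) \<partial>lborel)" .
  qed
  also have "\<dots> = (\<integral>\<^sup>+w. (\<integral>\<^sup>+x. ennreal (norm (u (x + c *\<^sub>R w) - u x)) * ennreal (gauss_kernel 1 w) \<partial>lborel) \<partial>lborel)"
    by (rule lborel_pair.Fubini') measurable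
  also have "\<dots> = (\<integral>\<^sup>+w. ennreal (gauss_kernel 1 w) * (\<integral>\<^sup>+x. ennreal (norm (u (x + c *\<^sub>R w) - u x)) \<partial>lborel) \<partial>lborel)"
    by (subst nn_integral_multc) (simp_all add: mult.commute)
  finally show ?thesis .
qed

text \<open>The translation errors tend to 0 for each \<open>w\<close> and are at most twice the L^1
  norm of \<open>u\<close>, so dominated convergence against the fixed kernel gives convergence in
  L^1, hence almost everywhere along a subsequence.\<close>

lemma fourier_inversion_AE_subseq:
  fixes u :: "'a::euclidean_space \<Rightarrow> complex"
  assumes u: "integrable lborel u"
  obtains c :: "nat \<Rightarrow> real" where "\<And>n. c n > 0"
    "AE x in lborel. (\<lambda>n. fourier (\<lambda>\<xi>. fourier u \<xi> * complex_of_real (gauss (c n) \<xi>)) (- x)) \<longlonglongrightarrow> u x"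
proof -
  have [measurable]: "u \<in> borel_measurable borel" using u by auto
  define d where "d n = 1 / real (Suc n)" for n
  have d: "d n > 0" for n by (simp add: d_def)
  have d0: "d \<longlonglongrightarrow> 0"
    unfolding d_def by (rule lim_1_over_n[THEN LIMSEQ_Suc])
  define v where "v n x = fourier (\<lambda>\<xi>. fourier u \<xi> * complex_of_real (gauss (d n) \<xi>)) (- x) - u x" for n x
  have vm[measurable]: "v n \<in> borel_measurable borel" for n
    unfolding v_def
    by (intro borel_measurable_diff measurable_compose[of uminus borel borel, OF _ borel_measurable_fourier]) measurable
  define N where "N = (\<integral>\<^sup>+x. ennreal (norm (u x)) \<partial>lborel)"
  have N: "N < \<infinity>" using u by (simp add: N_def integrable_iff_bounded)
  define W where "W y = (\<integral>\<^sup>+x. ennreal (norm (u (x + y) - u x)) \<partial>lborel)" for y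
  have [measurable]: "W \<in> borel_measurable borel"
    unfolding W_def by measurable
  have W_le: "W y \<le> 2 * N" for y
  proof -
    have "W y \<le> (\<integral>\<^sup>+x. ennreal (norm (u (x + y))) + ennreal (norm (u x)) \<partial>lborel)"
      unfolding W_def
      by (intro nn_integral_mono) (simp flip: ennreal_plus add: norm_triangle_ineq4 ennreal_leI)
    also have "\<dots> = (\<integral>\<^sup>+x. ennreal (norm (u (x + y))) \<partial>lborel) + N"
      unfolding N_def by (rule nn_integral_add) measurable
    also have "(\<integral>\<^sup>+x. ennreal (norm (u (x + y))) \<partial>lborel) = N"
      using nn_integral_shift(1)[of "\<lambda>x. ennreal (norm (u x))" y] by (simp add: N_def add.commute)
    finally show ?thesis by (simp add: mult_2)
  qed
  have tot: "(\<integral>\<^sup>+w. ennreal (gauss_kernel 1 w) * (2 * N) \<partial>(lborel :: 'a measure)) = 2 * N"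
    by (simp add: nn_integral_multc nn_integral_gauss_kernel)
  have vle: "(\<integral>\<^sup>+x. ennreal (norm (v n x)) \<partial>lborel) \<le> (\<integral>\<^sup>+w. ennreal (gauss_kernel 1 w) * W (d n *\<^sub>R w) \<partial>lborel)" for n
    unfolding v_def W_def by (rule fourier_gauss_L1_error[OF u d])
  have vfin: "(\<integral>\<^sup>+x. ennreal (norm (v n x)) \<partial>lborel) < \<infinity>" for n
  proof -
    have "(\<integral>\<^sup>+x. ennreal (norm (v n x)) \<partial>lborel) \<le> (\<integral>\<^sup>+w. ennreal (gauss_kernel 1 w) * (2 * N) \<partial>(lborel :: 'a measure))"
      by (intro order_trans[OF vle] nn_integral_mono mult_left_mono W_le) simp
    also have "\<dots> < \<infinity>" using N by (simp add: tot ennreal_mult_less_top)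
    finally show ?thesis .
  qed
  have vi: "integrable lborel (v n)" for n
    using vfin by (intro integrableI_bounded) simp_all
  have "(\<lambda>n. \<integral>\<^sup>+w. ennreal (gauss_kernel 1 w) * W (d n *\<^sub>R w) \<partial>lborel) \<longlonglongrightarrow> (\<integral>\<^sup>+w. 0 \<partial>(lborel :: 'a measure))"
  proof (rule nn_integral_dominated_convergence[where w="\<lambda>w. ennreal (gauss_kernel 1 w) * (2 * N)"])
    show "AE w in lborel. ennreal (gauss_kernel 1 w) * W (d n *\<^sub>R w) \<le> ennreal (gauss_kernel 1 w) * (2 * N)" for n
      by (intro AE_I2 mult_left_mono W_le) simp
    show "(\<integral>\<^sup>+w. ennreal (gauss_kernel 1 w) * (2 * N) \<partial>(lborel :: 'a measure)) < \<infinity>"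
      using N by (simp add: tot ennreal_mult_less_top)
    show "AE w in lborel. (\<lambda>n. ennreal (gauss_kernel 1 w) * W (d n *\<^sub>R w)) \<longlonglongrightarrow> 0"
    proof (rule AE_I2)
      fix w :: 'a
      have "(\<lambda>n. d n *\<^sub>R w) \<longlonglongrightarrow> 0 *\<^sub>R w" by (intro tendsto_intros d0)
      then have "(\<lambda>n. W (d n *\<^sub>R w)) \<longlonglongrightarrow> 0"
        using integrable_L1_translation_continuous[OF u] by (simp add: L1_translation_continuous_def W_def)
      from ennreal_tendsto_cmult[OF _ this, of "ennreal (gauss_kernel 1 w)"]
      show "(\<lambda>n. ennreal (gauss_kernel 1 w) * W (d n *\<^sub>R w)) \<longlonglongrightarrow> 0"
        by simp
    qed
  qed measurable
  then have "(\<lambda>n. \<integral>\<^sup>+w. ennreal (gauss_kernel 1 w) * W (d n *\<^sub>R w) \<partial>lborel) \<longlonglongrightarrow> 0"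
    by simp
  then have nv0: "(\<lambda>n. \<integral>\<^sup>+x. ennreal (norm (v n x)) \<partial>lborel) \<longlonglongrightarrow> 0"
    by (rule tendsto_sandwich[OF _ _ tendsto_const, rotated 2]) (simp_all add: vle)
  have "(\<integral>\<^sup>+x. ennreal (norm (v n x)) \<partial>lborel) = ennreal (LINT x|lborel. norm (v n x))" for n
    by (intro nn_integral_eq_integral) (simp_all add: vi)
  with nv0 have "(\<lambda>n. ennreal (LINT x|lborel. norm (v n x))) \<longlonglongrightarrow> ennreal 0"
    by simp
  then have "(\<lambda>n. LINT x|lborel. norm (v n x)) \<longlonglongrightarrow> 0"
    by (rule tendsto_ennrealD) simp_all
  from tendsto_L1_AE_subseq[OF vi this] obtain r :: "nat \<Rightarrow> nat"
    where "AE x in lborel. (\<lambda>n. v (r n) x) \<longlonglongrightarrow> 0" by blast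
  then have "AE x in lborel. (\<lambda>n. fourier (\<lambda>\<xi>. fourier u \<xi> * complex_of_real (gauss (d (r n)) \<xi>)) (- x)) \<longlonglongrightarrow> u x"
  proof eventually_elim
    case (elim x)
    from tendsto_add[OF this tendsto_const[of "u x"]] show ?case
      by (simp add: v_def)
  qed
  then show ?thesis
    using that[of "\<lambda>n. d (r n)"] d by blast
qed

section \<open>Norms and the Hausdorff-Young inequality\<close>

lemma ennreal_powr_ennreal: "0 \<le> x \<Longrightarrow> ennreal_powr (ennreal x) a = ennreal (x powr a)"
  by (simp add: ennreal_powr_def)

lemma ennreal_powr_top [simp]: "ennreal_powr top a = top"
  by (simp add: ennreal_powr_def)

lemma ennreal_powr_mono:
  assumes "s \<le> t" "0 \<le> a"
  shows "ennreal_powr s a \<le> ennreal_powr t a"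
proof (cases "t = top")
  case False
  then have "s \<noteq> top" using assms by (auto simp: top_unique)
  with False assms show ?thesis
    by (auto simp: ennreal_powr_def less_top intro!: ennreal_leI powr_mono2 enn2real_mono)
qed simp

lemma ennreal_powr_cmult:
  assumes "0 < c" "0 < a"
  shows "ennreal_powr (ennreal c * s) a = ennreal (c powr a) * ennreal_powr s a"
proof (cases s)
  case (real x)
  with assms show ?thesis
    by (simp add: ennreal_powr_ennreal powr_mult flip: ennreal_mult)
next
  case top
  with assms show ?thesis
    by (simp add: ennreal_mult_top)
qed

lemma Lq_norm_top: "Lq_norm top f = esssup lebesgue (\<lambda>x. ennreal (norm (f x)))"
  by (simp add: Lq_norm_def)

lemma Lq_norm_ennreal:
  "0 \<le> r \<Longrightarrow> Lq_norm (ennreal r) f = ennreal_powr (\<integral>\<^sup>+x. ennreal (norm (f x) powr r) \<partial>lebesgue) (1 / r)"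
  by (simp add: Lq_norm_def)

lemma Lq_norm_cong_AE:
  assumes "AE x in lebesgue. f x = g x" "f \<in> borel_measurable lebesgue" "g \<in> borel_measurable lebesgue"
  shows "Lq_norm q f = Lq_norm q g"
proof -
  have "(\<integral>\<^sup>+x. ennreal (norm (f x) powr enn2real q) \<partial>lebesgue) = (\<integral>\<^sup>+x. ennreal (norm (g x) powr enn2real q) \<partial>lebesgue)"
    using assms(1) by (intro nn_integral_cong_AE) auto
  moreover have "esssup lebesgue (\<lambda>x. ennreal (norm (f x))) = esssup lebesgue (\<lambda>x. ennreal (norm (g x)))"
    using assms by (intro esssup_AE_cong) auto
  ultimately show ?thesis
    by (simp add: Lq_norm_def)
qed

lemma Lq_norm_le_cmult:
  assumes f: "f \<in> borel_measurable lebesgue" and g: "g \<in> borel_measurable lebesgue"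
    and c: "0 < c" and q: "0 < q"
    and le: "AE x in lebesgue. norm (f x) \<le> c * norm (g x)"
  shows "Lq_norm q f \<le> ennreal c * Lq_norm q g"
proof (cases q)
  case (real r)
  with q have r: "r > 0" by simp
  have "(\<integral>\<^sup>+x. ennreal (norm (f x) powr r) \<partial>lebesgue) \<le> (\<integral>\<^sup>+x. ennreal (c powr r) * ennreal (norm (g x) powr r) \<partial>lebesgue)"
  proof (rule nn_integral_mono_AE)
    show "AE x in lebesgue. ennreal (norm (f x) powr r) \<le> ennreal (c powr r) * ennreal (norm (g x) powr r)"
      using le
    proof eventually_elim
      case (elim x)
      then have "norm (f x) powr r \<le> (c * norm (g x)) powr r"
        using r by (intro powr_mono2) auto
      also have "\<dots> = c powr r * norm (g x) powr r"
        by (rule powr_mult)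
      finally show ?case
        by (simp add: ennreal_leI flip: ennreal_mult)
    qed
  qed
  also have "\<dots> = ennreal (c powr r) * (\<integral>\<^sup>+x. ennreal (norm (g x) powr r) \<partial>lebesgue)"
    using g by (intro nn_integral_cmult) simp
  finally have "Lq_norm q f \<le> ennreal_powr (ennreal (c powr r) * (\<integral>\<^sup>+x. ennreal (norm (g x) powr r) \<partial>lebesgue)) (1 / r)"
    using r by (simp add: real Lq_norm_ennreal ennreal_powr_mono)
  also have "\<dots> = ennreal c * Lq_norm q g"
    using r c by (simp add: real Lq_norm_ennreal ennreal_powr_cmult powr_powr)
  finally show ?thesis .
next
  case top
  have "AE x in lebesgue. ennreal (norm (f x)) \<le> ennreal c * Lq_norm top g"
    using le esssup_AE[of "\<lambda>x. ennreal (norm (g x))" lebesgue]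
  proof eventually_elim
    case (elim x)
    then have "ennreal (norm (f x)) \<le> ennreal c * ennreal (norm (g x))"
      using c by (simp add: ennreal_leI flip: ennreal_mult)
    also have "\<dots> \<le> ennreal c * Lq_norm top g"
      using elim by (intro mult_left_mono) (simp_all add: Lq_norm_top)
    finally show ?case .
  qed
  then show ?thesis
    using f by (simp add: top Lq_norm_top esssup_I)
qed

text \<open>In extended arithmetic 1 / 0 is \<infinity> and 1 / \<infinity> is 0, so the relation
  itself rules out \<open>q' = 0\<close> and leaves the endpoint or a pair of real
  exponents.\<close>

lemma conjugate_exponent_cases:
  fixes q q' :: ennreal
  assumes "2 \<le> q" "1 / q + 1 / q' = 1"
  obtains "q = top" "q' = 1"
  | r where "r \<ge> 2" "q = ennreal r" "q' = ennreal (r / (r - 1))"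
proof (cases q)
  case (real r)
  then have r: "r \<ge> 2"
    using assms(1) by (simp flip: ennreal_numeral)
  then have 1: "1 / q = ennreal (1 / r)"
    using real by (simp add: divide_ennreal flip: ennreal_1)
  show ?thesis
  proof (cases q')
    case (real p)
    have "p \<noteq> 0"
    proof
      assume "p = 0"
      then have "1 / q' = top" using real by simp
      then show False using assms(2) by simp
    qed
    with real have p: "p > 0" by simp
    then have "1 / q' = ennreal (1 / p)"
      using real by (simp add: divide_ennreal flip: ennreal_1)
    with assms(2) 1 have "ennreal (1 / r + 1 / p) = ennreal 1"
      using r p by simp
    then have "1 / r + 1 / p = 1"
      using r p by (subst (asm) ennreal_inj) auto
    then have "p = r / (r - 1)"
      using r p by (simp add: field_simps)
    then show ?thesis
      using that(2)[of r] r real \<open>q = ennreal r\<close> by simp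
  next
    case top
    then have "ennreal (1 / r) = ennreal 1"
      using assms(2) 1 by simp
    then show ?thesis
      using r by (subst (asm) ennreal_inj) auto
  qed
next
  case top
  have "1 / q' = 1" using assms(2) top by simp
  have "q' = 1"
  proof (cases q')
    case (real p)
    have "p \<noteq> 0"
      using \<open>1 / q' = 1\<close> real by auto
    with real have "1 / q' = ennreal (1 / p)"
      by (simp add: divide_ennreal flip: ennreal_1)
    with \<open>1 / q' = 1\<close> have "ennreal (1 / p) = ennreal 1" by simp
    then have "1 / p = 1"
      using real by (subst (asm) ennreal_inj) auto
    then show ?thesis using real \<open>p \<noteq> 0\<close> by simp
  qed (use \<open>1 / q' = 1\<close> in simp)
  with top that(1) show ?thesis by simp
qed

text \<open>Real and imaginary parts have Borel representatives separately. This is how statements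
  for \<open>lebesgue\<close> are reduced to \<open>lborel\<close>.\<close>

lemma completion_ex_borel_measurable_complex:
  fixes g :: "'a \<Rightarrow> complex"
  assumes g: "g \<in> borel_measurable (completion M)"
  obtains g' where "g' \<in> borel_measurable M" "AE x in M. g x = g' x"
proof -
  have "(\<lambda>x. Re (g x)) \<in> borel_measurable (completion M)" "(\<lambda>x. Im (g x)) \<in> borel_measurable (completion M)"
    using g by measurable
  from this[THEN completion_ex_borel_measurable_real]
  obtain a b where [measurable]: "a \<in> borel_measurable M" "b \<in> borel_measurable M"
    and ab: "AE x in M. Re (g x) = a x" "AE x in M. Im (g x) = b x"
    by blast
  show ?thesis
  proof (rule that[of "\<lambda>x. complex_of_real (a x) + \<i> * complex_of_real (b x)"])
    show "AE x in M. g x = complex_of_real (a x) + \<i> * complex_of_real (b x)"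
      using ab by eventually_elim (simp add: complex_eq_iff)
  qed measurable
qed

text \<open>The interpolation constant blows up as \<open>r\<close> tends to 2, where Plancherel is
  the claim itself. The bound is phrased with a positive real \<open>H\<close> in place of the
  integral, so that real powers can be used.\<close>

lemma hausdorff_young_powr:
  fixes r :: real
  assumes r: "r \<ge> 2"
  obtains C where "C > 0"
    "\<And>(h :: 'a::euclidean_space \<Rightarrow> complex) H. integrable lborel h \<Longrightarrow> H > 0 \<Longrightarrow>
      (\<integral>\<^sup>+x. ennreal (norm (h x) powr (r / (r - 1))) \<partial>lborel) \<le> ennreal H \<Longrightarrow>
      (\<integral>\<^sup>+x. ennreal (norm (fourier h x) powr r) \<partial>lborel) \<le> ennreal (C * H powr (r - 1))"
proof (cases "r = 2")
  case True
  show ?thesis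
  proof (rule that[of 1])
    fix h :: "'a \<Rightarrow> complex" and H :: real
    assume h: "integrable lborel h" and H: "H > 0"
      and le: "(\<integral>\<^sup>+x. ennreal (norm (h x) powr (r / (r - 1))) \<partial>lborel) \<le> ennreal H"
    from order_trans[OF plancherel_le[OF h]] le H True
    show "(\<integral>\<^sup>+x. ennreal (norm (fourier h x) powr r) \<partial>lborel) \<le> ennreal (1 * H powr (r - 1))"
      by simp
  qed simp
next
  case False
  with r have r: "r > 2" by simp
  show ?thesis
    by (rule that[of "4 * r * 2 powr (r - 2) / (r - 2)"])
       (use r in simp, rule hausdorff_young_interpolated[OF _ r])
qed

text \<open>The forward inequality is applied to the Gaussian-damped transform of \<open>u\<close>,
  which is integrable and no larger in modulus than the transform. Its reflected transform tends to
  \<open>u\<close> almost everywhere, and Fatou's lemma concludes.\<close>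

lemma inverse_hausdorff_young_powr:
  fixes r :: real
  assumes r: "r \<ge> 2"
  obtains C where "C > 0"
    "\<And>(u :: 'a::euclidean_space \<Rightarrow> complex) H. integrable lborel u \<Longrightarrow> H > 0 \<Longrightarrow>
      (\<integral>\<^sup>+x. ennreal (norm (fourier u x) powr (r / (r - 1))) \<partial>lborel) \<le> ennreal H \<Longrightarrow>
      (\<integral>\<^sup>+x. ennreal (norm (u x) powr r) \<partial>lborel) \<le> ennreal (C * H powr (r - 1))"
proof -
  obtain C where C: "C > 0" and hy:
    "\<And>(h :: 'a \<Rightarrow> complex) H. integrable lborel h \<Longrightarrow> H > 0 \<Longrightarrow>
      (\<integral>\<^sup>+x. ennreal (norm (h x) powr (r / (r - 1))) \<partial>lborel) \<le> ennreal H \<Longrightarrow>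
      (\<integral>\<^sup>+x. ennreal (norm (fourier h x) powr r) \<partial>lborel) \<le> ennreal (C * H powr (r - 1))"
    by (rule hausdorff_young_powr[OF r]) (rule that, assumption+)
  show ?thesis
  proof (rule that[OF C])
    fix u :: "'a \<Rightarrow> complex" and H :: real
    assume u: "integrable lborel u" and H: "H > 0"
      and le: "(\<integral>\<^sup>+x. ennreal (norm (fourier u x) powr (r / (r - 1))) \<partial>lborel) \<le> ennreal H"
    have [measurable]: "u \<in> borel_measurable borel" using u by auto
    obtain c where c: "\<And>n::nat. c n > 0"
      and lim: "AE x in lborel. (\<lambda>n. fourier (\<lambda>\<xi>. fourier u \<xi> * complex_of_real (gauss (c n) \<xi>)) (- x)) \<longlonglongrightarrow> u x"
      by (rule fourier_inversion_AE_subseq[OF u]) (rule that, assumption+)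
    let ?h = "\<lambda>n \<xi>. fourier u \<xi> * complex_of_real (gauss (c n) \<xi>)"
    have m: "(\<lambda>x. ennreal (norm (fourier (?h n) x) powr r)) \<in> borel_measurable borel" for n
      by measurable
    show "(\<integral>\<^sup>+x. ennreal (norm (u x) powr r) \<partial>lborel) \<le> ennreal (C * H powr (r - 1))"
    proof (rule nn_integral_le_of_tendsto)
      show "(\<lambda>x. ennreal (norm (fourier (?h n) (- x)) powr r)) \<in> borel_measurable lborel" for n
        using measurable_compose[OF _ m, of uminus borel n] by simp
      have "(\<integral>\<^sup>+x. ennreal (norm (?h n x) powr (r / (r - 1))) \<partial>lborel) \<le> ennreal H" for n
      proof -
        have "norm (?h n x) \<le> norm (fourier u x)" for x
          using gauss_pos[of "c n" x] gauss_le_1[of "c n" x] by (simp add: norm_mult mult_left_le)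
        then show ?thesis
          using r by (intro order_trans[OF nn_integral_mono le] ennreal_leI powr_mono2) auto
      qed
      from hy[OF integrable_fourier_gauss[OF u c] H this]
      show "(\<integral>\<^sup>+x. ennreal (norm (fourier (?h n) (- x)) powr r) \<partial>lborel) \<le> ennreal (C * H powr (r - 1))" for n
        using nn_integral_shift(4)[OF m, of n] by simp
      show "AE x in lborel. (\<lambda>n. ennreal (norm (fourier (?h n) (- x)) powr r)) \<longlonglongrightarrow> ennreal (norm (u x) powr r)"
        using lim
      proof eventually_elim
        case (elim x)
        show ?case
          using r by (intro tendsto_ennrealI tendsto_powr' tendsto_norm elim tendsto_const) auto
      qed
    qed
  qed
qed

text \<open>The endpoint case: the transform of each damped function is bounded everywhere by the
  L^1 norm of \<open>fourier u\<close>, and the bound passes to the almost everywhere limit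
  \<open>u\<close>.\<close>

lemma inverse_hausdorff_young_sup:
  fixes u :: "'a::euclidean_space \<Rightarrow> complex"
  assumes u: "integrable lborel u"
  shows "AE x in lborel. ennreal (norm (u x)) \<le> (\<integral>\<^sup>+\<xi>. ennreal (norm (fourier u \<xi>)) \<partial>lborel)"
proof -
  obtain c where c: "\<And>n::nat. c n > 0"
    and lim: "AE x in lborel. (\<lambda>n. fourier (\<lambda>\<xi>. fourier u \<xi> * complex_of_real (gauss (c n) \<xi>)) (- x)) \<longlonglongrightarrow> u x"
    by (rule fourier_inversion_AE_subseq[OF u]) (rule that, assumption+)
  let ?h = "\<lambda>n \<xi>. fourier u \<xi> * complex_of_real (gauss (c n) \<xi>)"
  have "ennreal (norm (fourier (?h n) x)) \<le> (\<integral>\<^sup>+\<xi>. ennreal (norm (fourier u \<xi>)) \<partial>lborel)" for n x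
  proof -
    have "norm (?h n \<xi>) \<le> norm (fourier u \<xi>)" for \<xi>
      using gauss_pos[of "c n" \<xi>] gauss_le_1[of "c n" \<xi>] by (simp add: norm_mult mult_left_le)
    then show ?thesis
      by (intro order_trans[OF norm_fourier_le[OF integrable_fourier_gauss[OF u c]]] nn_integral_mono ennreal_leI)
  qed
  then show ?thesis
    using lim by (auto elim!: eventually_mono intro: LIMSEQ_le_const2[OF tendsto_ennrealI[OF tendsto_norm]])
qed

theorem inverse_hausdorff_young:
  fixes q q' :: ennreal
  assumes q: "2 \<le> q" "1 / q + 1 / q' = 1"
  obtains C :: real where "C > 0"
    "\<And>u :: 'a::euclidean_space \<Rightarrow> complex. integrable lebesgue u \<Longrightarrow>
      Lq_norm q u \<le> ennreal C * Lq_norm q' (fourier u)"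
proof -
  have borel: "\<exists>C>0. \<forall>u :: 'a \<Rightarrow> complex. integrable lborel u \<longrightarrow>
      Lq_norm q u \<le> ennreal C * Lq_norm q' (fourier u)"
    using q
  proof (cases rule: conjugate_exponent_cases)
    case 1
    have "Lq_norm q u \<le> ennreal 1 * Lq_norm q' (fourier u)" if u: "integrable lborel u" for u :: "'a \<Rightarrow> complex"
    proof -
      have "Lq_norm 1 (fourier u) = (\<integral>\<^sup>+\<xi>. ennreal (norm (fourier u \<xi>)) \<partial>lborel)"
        using Lq_norm_ennreal[of 1 "fourier u"]
        by (cases "\<integral>\<^sup>+\<xi>. ennreal (norm (fourier u \<xi>)) \<partial>lborel")
           (simp_all add: nn_integral_completion ennreal_powr_ennreal)
      moreover have "esssup lebesgue (\<lambda>x. ennreal (norm (u x))) \<le> (\<integral>\<^sup>+\<xi>. ennreal (norm (fourier u \<xi>)) \<partial>lborel)"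
        using inverse_hausdorff_young_sup[OF u] u
        by (intro esssup_I measurable_completion) (auto simp: AE_completion_iff)
      ultimately show ?thesis
        by (simp add: 1 Lq_norm_top)
    qed
    then show ?thesis
      by (intro exI[of _ 1]) auto
  next
    case (2 r)
    define p where "p = r / (r - 1)"
    \<comment> \<open>Taking r-th roots turns the power \<open>r - 1\<close> of the integral into
      the p-th root that defines the dual norm.\<close>
    have p: "p > 0" and e: "(r - 1) * (1 / r) = 1 / p"
      using 2 by (auto simp: p_def field_simps)
    obtain C where C: "C > 0" and hy:
      "\<And>(u :: 'a \<Rightarrow> complex) H. integrable lborel u \<Longrightarrow> H > 0 \<Longrightarrow>
        (\<integral>\<^sup>+x. ennreal (norm (fourier u x) powr p) \<partial>lborel) \<le> ennreal H \<Longrightarrow>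
        (\<integral>\<^sup>+x. ennreal (norm (u x) powr r) \<partial>lborel) \<le> ennreal (C * H powr (r - 1))"
      by (rule inverse_hausdorff_young_powr[OF 2(1), folded p_def]) (rule that, assumption+)
    have bd: "Lq_norm q u \<le> ennreal (C powr (1 / r)) * ennreal (H powr (1 / p))"
      if "integrable lborel u" "H > 0" "(\<integral>\<^sup>+x. ennreal (norm (fourier u x) powr p) \<partial>lborel) \<le> ennreal H"
      for u :: "'a \<Rightarrow> complex" and H
    proof -
      have "Lq_norm q u \<le> ennreal_powr (ennreal (C * H powr (r - 1))) (1 / r)"
        using 2 hy[OF that] by (simp add: Lq_norm_ennreal ennreal_powr_mono nn_integral_completion)
      also have "\<dots> = ennreal (C powr (1 / r) * (H powr (r - 1)) powr (1 / r))"
        using C that(2) by (simp add: ennreal_powr_ennreal powr_mult)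
      finally show ?thesis
        unfolding powr_powr e by (simp add: ennreal_mult)
    qed
    have "Lq_norm q u \<le> ennreal (C powr (1 / r)) * Lq_norm q' (fourier u)" if u: "integrable lborel u" for u :: "'a \<Rightarrow> complex"
    proof (cases "\<integral>\<^sup>+x. ennreal (norm (fourier u x) powr p) \<partial>lborel")
      case (real H)
      then have q': "Lq_norm q' (fourier u) = ennreal (H powr (1 / p))"
        using 2 p by (simp add: Lq_norm_ennreal nn_integral_completion ennreal_powr_ennreal flip: p_def)
      show ?thesis
      proof (cases "H > 0")
        case True
        then show ?thesis using bd[OF u True] real q' by simp
      next
        case False
        \<comment> \<open>Here the integral is 0 and not itself a legitimate \<open>H\<close>. Every
          positive \<open>H\<close> bounds it, and letting \<open>H\<close> tend to 0 gives the
          estimate.\<close>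
        have lim: "((\<lambda>H. ennreal (C powr (1 / r)) * ennreal (H powr (1 / p))) \<longlongrightarrow> ennreal (C powr (1 / r)) * ennreal (0 powr (1 / p))) (at_right 0)"
          using p by (intro ennreal_tendsto_cmult tendsto_ennrealI tendsto_powr' tendsto_ident_at tendsto_const)
            (auto simp: eventually_at_filter)
        have "eventually (\<lambda>H. Lq_norm q u \<le> ennreal (C powr (1 / r)) * ennreal (H powr (1 / p))) (at_right 0)"
          using eventually_at_right_less[of 0]
        proof eventually_elim
          case (elim H')
          show ?case
            using False real elim by (intro bd[OF u]) auto
        qed
        then show ?thesis
          using tendsto_lowerbound[OF lim] False real q' by simp
      qed
    next
      case top
      then have "Lq_norm q' (fourier u) = top"
        using 2 p by (simp add: Lq_norm_ennreal nn_integral_completion flip: p_def)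
      then show ?thesis using C by (simp add: ennreal_mult_top)
    qed
    then show ?thesis
      using C by (intro exI[of _ "C powr (1 / r)"]) auto
  qed
  then obtain C where C: "C > 0" and hy:
    "\<And>u :: 'a \<Rightarrow> complex. integrable lborel u \<Longrightarrow> Lq_norm q u \<le> ennreal C * Lq_norm q' (fourier u)"
    by blast
  show ?thesis
  proof (rule that[OF C])
    fix u :: "'a \<Rightarrow> complex" assume u: "integrable lebesgue u"
    then have um: "u \<in> borel_measurable lebesgue" by auto
    then obtain v where v[measurable]: "v \<in> borel_measurable lborel" and uv: "AE x in lborel. u x = v x"
      by (rule completion_ex_borel_measurable_complex)
    have vm: "v \<in> borel_measurable lebesgue"
      by (rule measurable_completion) simp
    have uv': "AE x in lebesgue. u x = v x"
      using uv by (rule AE_completion)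
    have "integrable lebesgue v"
      using u by (rule integrable_cong_AE_imp[OF _ vm]) (use uv' in auto)
    then have "integrable lborel v"
      by (subst (asm) integrable_completion) auto
    from hy[OF this] show "Lq_norm q u \<le> ennreal C * Lq_norm q' (fourier u)"
      using Lq_norm_cong_AE[OF uv' um vm] fourier_cong_AE[OF uv' um] v by simp
  qed
qed

section \<open>Iterated differences and broken powers\<close>

text \<open>The binomial expansion of (1 - T)^N, where T is translation by \<open>h\<close>. The
  explicit sum lets the term \<open>k = 0\<close>, which is \<open>f x\<close>, be isolated
  pointwise.\<close>

definition shift_difference :: "nat \<Rightarrow> 'a::euclidean_space \<Rightarrow> ('a \<Rightarrow> complex) \<Rightarrow> 'a \<Rightarrow> complex" where
  "shift_difference N h f x = (\<Sum>k\<le>N. of_nat (N choose k) * (- 1) ^ k * f (x - real k *\<^sub>R h))"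

lemma borel_measurable_shift_difference [measurable]:
  assumes [measurable]: "f \<in> borel_measurable borel"
  shows "shift_difference N h f \<in> borel_measurable borel"
  unfolding shift_difference_def[abs_def] by measurable

lemma integrable_shift:
  fixes f :: "'a::euclidean_space \<Rightarrow> complex"
  assumes f: "integrable lborel f"
  shows "integrable lborel (\<lambda>x. f (x - a))"
proof -
  have [measurable]: "f \<in> borel_measurable borel" using f by auto
  have "(\<integral>\<^sup>+x. ennreal (norm (f (x - a))) \<partial>lborel) < \<infinity>"
    using nn_integral_shift(2)[of "\<lambda>x. ennreal (norm (f x))" a] f by (simp add: integrable_iff_bounded)
  then show ?thesis
    by (intro integrableI_bounded) measurable
qed

lemma integrable_shift_difference:
  fixes f :: "'a::euclidean_space \<Rightarrow> complex"
  assumes f: "integrable lborel f"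
  shows "integrable lborel (shift_difference N h f)"
  unfolding shift_difference_def[abs_def]
  by (intro Bochner_Integration.integrable_sum integrable_mult_right integrable_shift f)

lemma fourier_shift:
  fixes f :: "'a::euclidean_space \<Rightarrow> complex"
  assumes [measurable]: "f \<in> borel_measurable borel"
  shows "fourier (\<lambda>x. f (x - a)) \<xi> = cis (- (2 * pi * (a \<bullet> \<xi>))) * fourier f \<xi>"
proof -
  have "fourier (\<lambda>x. f (x - a)) \<xi> = (LINT x|lborel. f (x - a) * cis (- (2 * pi * (x \<bullet> \<xi>))))"
    by (rule fourier_lborel) measurable
  also have "\<dots> = (LINT x|lborel. f x * cis (- (2 * pi * ((a + x) \<bullet> \<xi>))))"
    using integral_affine_euclidean[of "\<lambda>x. f (x - a) * cis (- (2 * pi * (x \<bullet> \<xi>)))" 1 a] by simp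
  also have "\<dots> = (LINT x|lborel. cis (- (2 * pi * (a \<bullet> \<xi>))) * (f x * cis (- (2 * pi * (x \<bullet> \<xi>)))))"
    by (simp add: inner_add_left ring_distribs mult.left_commute cis_mult)
  also have "\<dots> = cis (- (2 * pi * (a \<bullet> \<xi>))) * fourier f \<xi>"
    by (simp add: fourier_lborel)
  finally show ?thesis .
qed

text \<open>Each translation becomes multiplication by a power of one unimodular number
  \<open>w\<close>, and the binomial theorem sums the series.\<close>

lemma fourier_shift_difference:
  fixes f :: "'a::euclidean_space \<Rightarrow> complex"
  assumes f: "integrable lborel f"
  shows "fourier (shift_difference N h f) \<xi> = (1 - cis (- (2 * pi * (h \<bullet> \<xi>)))) ^ N * fourier f \<xi>"
proof -
  have [measurable]: "f \<in> borel_measurable borel" using f by auto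
  define w where "w = cis (- (2 * pi * (h \<bullet> \<xi>)))"
  have wk: "cis (- (2 * pi * ((real k *\<^sub>R h) \<bullet> \<xi>))) = w ^ k" for k
    using Complex.DeMoivre[of "- (2 * pi * (h \<bullet> \<xi>))" k] by (simp add: w_def mult_ac)
  let ?g = "\<lambda>k x. f (x - real k *\<^sub>R h) * cis (- (2 * pi * (x \<bullet> \<xi>)))"
  have ig: "integrable lborel (?g k)" for k
    by (intro integrable_mult_unit integrable_shift f) auto
  have Ig: "(LINT x|lborel. ?g k x) = w ^ k * fourier f \<xi>" for k
  proof -
    have "(LINT x|lborel. ?g k x) = fourier (\<lambda>x. f (x - real k *\<^sub>R h)) \<xi>"
      by (rule fourier_lborel[symmetric]) measurable
    also have "\<dots> = w ^ k * fourier f \<xi>"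
      by (simp only: fourier_shift[OF \<open>f \<in> borel_measurable borel\<close>] wk)
    finally show ?thesis .
  qed
  have "fourier (shift_difference N h f) \<xi>
      = (LINT x|lborel. (\<Sum>k\<le>N. of_nat (N choose k) * (- 1) ^ k * ?g k x))"
    by (subst fourier_lborel) (simp_all add: shift_difference_def sum_distrib_right mult.assoc)
  also have "\<dots> = (\<Sum>k\<le>N. of_nat (N choose k) * (- 1) ^ k * (LINT x|lborel. ?g k x))"
    by (subst Bochner_Integration.integral_sum) (simp_all add: ig)
  also have "\<dots> = (\<Sum>k\<le>N. of_nat (N choose k) * (- 1) ^ k * (w ^ k * fourier f \<xi>))"
    by (simp only: Ig)
  also have "\<dots> = (\<Sum>k\<le>N. of_nat (N choose k) * (- w) ^ k * 1 ^ (N - k)) * fourier f \<xi>"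
    by (simp add: sum_distrib_right power_minus[of w] mult.assoc)
  also have "\<dots> = (- w + 1) ^ N * fourier f \<xi>"
    by (simp only: binomial_ring)
  finally show ?thesis
    by (simp add: w_def)
qed

text \<open>The constant \<open>4 * pi\<close> covers both bounds on one factor: the trivial bound
  2, and the phase, which is at most \<open>2 * pi * norm h * norm \<xi>\<close> with
  \<open>norm h = 2 * R\<close>.\<close>

lemma norm_fourier_shift_difference_le:
  fixes f :: "'a::euclidean_space \<Rightarrow> complex"
  assumes f: "integrable lborel f" and h: "norm h = 2 * R"
  shows "norm (fourier (shift_difference N h f) \<xi>)
    \<le> (4 * pi) ^ N * min 1 (R * norm \<xi>) ^ N * norm (fourier f \<xi>)"
proof -
  have R: "R \<ge> 0" using h norm_ge_zero[of h] by linarith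
  let ?t = "- (2 * pi * (h \<bullet> \<xi>))"
  have "norm (1 - cis ?t) \<le> 2"
    using norm_triangle_ineq4[of 1 "cis ?t"] by simp
  then have 1: "norm (1 - cis ?t) \<le> 4 * pi * 1"
    using pi_gt3 by linarith
  have "norm (1 - cis ?t) \<le> \<bar>?t\<bar>"
    using iexp_approx1[of ?t 0] by (simp add: cis_conv_exp norm_minus_commute)
  also have "\<dots> = 2 * pi * \<bar>h \<bullet> \<xi>\<bar>"
    by (simp add: abs_mult)
  also have "\<dots> \<le> 2 * pi * (norm h * norm \<xi>)"
    by (intro mult_left_mono Cauchy_Schwarz_ineq2) simp
  finally have 2: "norm (1 - cis ?t) \<le> 4 * pi * (R * norm \<xi>)"
    using h by simp
  have "norm (1 - cis ?t) \<le> 4 * pi * min 1 (R * norm \<xi>)"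
    using 1 2 by (simp only: min_def split: if_split) simp
  then have "norm (1 - cis ?t) ^ N \<le> (4 * pi * min 1 (R * norm \<xi>)) ^ N"
    by (rule power_mono) simp
  then show ?thesis
    unfolding fourier_shift_difference[OF f] norm_mult norm_power
    by (intro mult_right_mono) (simp_all add: power_mult_distrib)
qed

section \<open>Broken powers\<close>

lemma borel_measurable_broken_powr [measurable]:
  assumes [measurable]: "g \<in> borel_measurable M"
  shows "(\<lambda>x. broken_powr C (g x)) \<in> borel_measurable M"
  unfolding broken_powr_def by measurable

lemma broken_powr_pos: "0 < s \<Longrightarrow> 0 < broken_powr C s"
  by (simp add: broken_powr_def)

lemma broken_powr_nonneg: "0 \<le> broken_powr C s"
  by (simp add: broken_powr_def)

lemma broken_powr_mono:
  assumes "0 \<le> fst C" "0 \<le> snd C" "0 \<le> s" "s \<le> t"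
  shows "broken_powr C s \<le> broken_powr C t"
proof (cases "s < 1 \<and> t \<ge> 1")
  case True
  then have "s powr fst C \<le> 1" "1 \<le> t powr snd C"
    using assms powr_mono2[of "fst C" s 1] ge_one_powr_ge_zero[of t "snd C"] by auto
  then show ?thesis using True by (simp add: broken_powr_def)
qed (use assms in \<open>auto simp: broken_powr_def intro: powr_mono2\<close>)

text \<open>Above the threshold \<open>1 / R\<close> the right-hand side is at least 1 by
  monotonicity. Below it the left-hand side is the N-th power of a ratio smaller than 1, and N
  dominates both exponents of \<open>B\<close>.\<close>

lemma min_power_le_broken_powr:
  assumes B: "0 < fst B" "0 < snd B" "fst B \<le> real N" "snd B \<le> real N" and R: "0 < R" and t: "0 < t"
  shows "min 1 (R * t) ^ N \<le> broken_powr B t / broken_powr B (1 / R)"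
proof (cases "1 / R \<le> t")
  case True
  then have "broken_powr B (1 / R) \<le> broken_powr B t"
    using B R by (intro broken_powr_mono) auto
  then have "1 \<le> broken_powr B t / broken_powr B (1 / R)"
    using R broken_powr_pos[of "1 / R" B] by simp
  moreover have "min 1 (R * t) ^ N \<le> 1"
    using R t by (intro power_le_one) auto
  ultimately show ?thesis by linarith
next
  case False
  define y where "y = 1 / R"
  have y: "y > 0" "t < y" and Ry: "R * t = t / y"
    using False R by (auto simp: y_def)
  have le1: "t / y \<le> 1" "0 < t / y" using y t by auto
  have p: "(t / y) ^ N \<le> (t / y) powr a" if "a \<le> real N" for a
    using powr_mono'[OF that, of "t / y"] le1 by (simp add: powr_realpow)
  have "(t / y) ^ N \<le> broken_powr B t / broken_powr B y"
  \<comment> \<open>When 1 separates \<open>t\<close> from \<open>y\<close> the two broken powers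
    use different exponents and numerator and denominator are compared separately; otherwise their
    quotient is a single power of \<open>t / y\<close>.\<close>
  proof (cases "t < 1 \<and> y \<ge> 1")
    case True
    have "(t / y) ^ N = t ^ N / y ^ N" by (rule power_divide)
    also have "\<dots> \<le> t powr fst B / y powr snd B"
    proof (rule frac_le)
      show "t ^ N \<le> t powr fst B"
        using powr_mono'[OF B(3), of t] True t by (simp add: powr_realpow)
      show "y powr snd B \<le> y ^ N"
        using powr_mono[OF B(4), of y] True y by (simp add: powr_realpow)
    qed (use y in auto)
    finally show ?thesis using True by (simp add: broken_powr_def)
  next
    case False
    then have "(t < 1 \<and> y < 1) \<or> (t \<ge> 1 \<and> y \<ge> 1)" using y by auto
    then show ?thesis
      using p[OF B(3)] p[OF B(4)] y t by (auto simp: broken_powr_def powr_divide)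
  qed
  then show ?thesis
    using le1 by (simp add: Ry y_def min_def)
qed

text \<open>Solving for \<open>R\<close> uses \<open>fst A\<close> exactly when
  \<open>c * s < 1\<close>, that is \<open>R < 1\<close>; then \<open>1 / R > 1\<close> selects
  \<open>snd B\<close>. This is the origin of the transposed exponents. The power of
  \<open>c\<close> absorbs the case in which \<open>s\<close> and \<open>c * s\<close> lie on
  different sides of 1.\<close>

lemma broken_powr_scale:
  fixes A B :: "real \<times> real"
  assumes A: "0 < fst A" "0 < snd A" and B: "0 < fst B" "0 < snd B" and c: "1 \<le> c" and s: "0 < s"
  obtains R where "R > 0" "broken_powr A R = c * s"
    "1 / broken_powr B (1 / R)
      \<le> c powr (snd B / fst A + fst B / snd A) * broken_powr (snd B / fst A, fst B / snd A) s"
proof -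
  define \<alpha> where "\<alpha> = snd B / fst A"
  define \<beta> where "\<beta> = fst B / snd A"
  have pos: "\<alpha> > 0" "\<beta> > 0" using A B by (auto simp: \<alpha>_def \<beta>_def)
  have cs: "c * s > 0" using c s by simp
  have c1: "c powr \<alpha> \<le> c powr (\<alpha> + \<beta>)" "c powr \<beta> \<le> c powr (\<alpha> + \<beta>)"
    using c pos by (auto intro!: powr_mono)
  show ?thesis
  proof (cases "c * s < 1")
    case True
    have "s \<le> c * s" using c s by simp
    with True have s1: "s < 1" by linarith
    define R where "R = (c * s) powr (1 / fst A)"
    have R: "R > 0" "R < 1"
      using cs True A powr_less_mono2[of "1 / fst A" "c * s" 1] c s by (simp_all add: R_def)
    have "1 / broken_powr B (1 / R) = R powr snd B"
      using R by (simp add: broken_powr_def powr_divide)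
    also have "\<dots> = (c * s) powr \<alpha>"
      by (simp add: R_def powr_powr \<alpha>_def)
    also have "\<dots> = c powr \<alpha> * s powr \<alpha>"
      by (rule powr_mult)
    also have "\<dots> \<le> c powr (\<alpha> + \<beta>) * s powr \<alpha>"
      using c1 by (intro mult_right_mono) auto
    finally show ?thesis
      using R A cs s1 by (intro that[of R]) (auto simp: broken_powr_def powr_powr R_def \<alpha>_def \<beta>_def)
  next
    case False
    define R where "R = (c * s) powr (1 / snd A)"
    have R: "R \<ge> 1"
      using False A by (auto simp: R_def intro: ge_one_powr_ge_zero)
    have "1 / broken_powr B (1 / R) = R powr fst B"
      using R by (auto simp: broken_powr_def powr_divide)
    also have "\<dots> = (c * s) powr \<beta>"
      by (simp add: R_def powr_powr \<beta>_def)
    also have "\<dots> = c powr \<beta> * s powr \<beta>"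
      by (rule powr_mult)
    also have "\<dots> \<le> c powr (\<alpha> + \<beta>) * broken_powr (\<alpha>, \<beta>) s"
    proof (cases "s < 1")
      case True
      \<comment> \<open>Here \<open>s < 1 \<le> c * s\<close>, so the exponent at hand is the wrong
        one: \<open>s powr \<beta>\<close> is bounded by 1, and 1 by
        \<open>(c * s) powr \<alpha>\<close>.\<close>
      have "c powr \<beta> * s powr \<beta> \<le> c powr \<beta> * 1"
        using True s pos powr_mono2[of \<beta> s 1] by (intro mult_left_mono) auto
      also have "\<dots> \<le> c powr \<beta> * (c * s) powr \<alpha>"
        using False pos by (intro mult_left_mono ge_one_powr_ge_zero) auto
      also have "\<dots> = c powr (\<alpha> + \<beta>) * s powr \<alpha>"
        by (simp add: powr_add powr_mult)
      finally show ?thesis using True by (simp add: broken_powr_def)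
    next
      case False
      then show ?thesis
        using c1 by (simp add: broken_powr_def mult_right_mono)
    qed
    finally show ?thesis
      using R A cs False by (intro that[of R]) (auto simp: broken_powr_def powr_powr R_def \<alpha>_def \<beta>_def)
  qed
qed

text \<open>Inside the ball only the term \<open>k = 0\<close> of the difference sees the ball, and
  the other binomial coefficients add up to at most \<open>2 ^ N\<close>. Outside it
  \<open>f x\<close> is itself a tail value. Keeping only the largest tail value gives one pointwise
  inequality that serves finite and infinite exponents alike.\<close>

lemma norm_le_shift_difference:
  fixes f :: "'a::euclidean_space \<Rightarrow> complex"
  assumes R: "R > 0" and h: "norm h = 2 * R"
  defines "out \<equiv> \<lambda>x. if norm x < R then 0 else f x"
  obtains k where "k \<le> N" "norm (f x) \<le> norm (shift_difference N h f x) + 2 ^ N * norm (out (x - real k *\<^sub>R h))"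
proof -
  define m where "m k = norm (out (x - real k *\<^sub>R h))" for k
  have "finite (m ` {..N})" "m ` {..N} \<noteq> {}" by auto
  from Max_in[OF this] obtain k where k: "k \<le> N" "m k = Max (m ` {..N})"
    by (metis imageE atMost_iff)
  have mk: "m j \<le> m k" if "j \<le> N" for j
    using that k by simp
  have "norm (f x) \<le> norm (shift_difference N h f x) + 2 ^ N * m k"
  proof (cases "norm x < R")
    case True
    let ?t = "\<lambda>k. of_nat (N choose k) * (- 1) ^ k * f (x - real k *\<^sub>R h)"
    have far: "norm (?t j) \<le> real (N choose j) * m k" if "j \<in> {..N} - {0}" for j
    proof -
      \<comment> \<open>A shift by at least \<open>2 * R\<close> moves a point of the open ball of
        radius \<open>R\<close> outside it, so \<open>out\<close> equals \<open>f\<close>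
        there.\<close>
      have "2 * R \<le> real j * (2 * R)"
        using that R mult_right_mono[of 1 "real j" "2 * R"] by simp
      also have "\<dots> = norm (real j *\<^sub>R h)" using h by simp
      also have "\<dots> \<le> norm (x - real j *\<^sub>R h) + norm x"
        using norm_triangle_ineq4[of x "x - real j *\<^sub>R h"] by simp
      finally have "out (x - real j *\<^sub>R h) = f (x - real j *\<^sub>R h)"
        using True by (simp add: out_def)
      then have "norm (?t j) = real (N choose j) * m j"
        by (simp add: m_def norm_mult norm_power)
      also have "\<dots> \<le> real (N choose j) * m k"
        using that by (intro mult_left_mono mk) auto
      finally show ?thesis .
    qed
    have "shift_difference N h f x = f x + (\<Sum>j\<in>{..N} - {0}. ?t j)"
      unfolding shift_difference_def by (subst sum.remove[of _ 0]) auto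
    then have "norm (f x) \<le> norm (shift_difference N h f x) + norm (\<Sum>j\<in>{..N} - {0}. ?t j)"
      using norm_triangle_ineq4[of "shift_difference N h f x" "\<Sum>j\<in>{..N} - {0}. ?t j"] by simp
    also have "norm (\<Sum>j\<in>{..N} - {0}. ?t j) \<le> (\<Sum>j\<in>{..N} - {0}. real (N choose j) * m k)"
      by (rule order_trans[OF norm_sum sum_mono[OF far]])
    also have "\<dots> \<le> (\<Sum>j\<le>N. real (N choose j) * m k)"
      by (rule sum_mono2) (auto simp: m_def)
    also have "\<dots> = 2 ^ N * m k"
      using choose_row_sum[of N] by (simp flip: sum_distrib_right of_nat_sum)
    finally show ?thesis by simp
  next
    case False
    have "norm (f x) = m 0" using False by (simp add: m_def out_def)
    also have "\<dots> \<le> m k" by (rule mk) simp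
    also have "\<dots> \<le> 2 ^ N * m k"
      using mult_right_mono[of 1 "2 ^ N" "m k"] by (simp add: m_def)
    finally show ?thesis using norm_ge_zero[of "shift_difference N h f x"] by linarith
  qed
  with k that show ?thesis by (simp add: m_def)
qed

section \<open>Absorbing the tails\<close>

lemma Lq_norm_eq_0_iff:
  fixes f :: "'a::euclidean_space \<Rightarrow> complex"
  assumes f: "f \<in> borel_measurable lebesgue" and q: "0 < q"
  shows "Lq_norm q f = 0 \<longleftrightarrow> (AE x in lebesgue. f x = 0)"
proof
  assume 0: "Lq_norm q f = 0"
  show "AE x in lebesgue. f x = 0"
  proof (cases q)
    case (real r)
    with q have r: "r > 0" by simp
    have "(\<integral>\<^sup>+x. ennreal (norm (f x) powr r) \<partial>lebesgue) = 0"
      using 0 r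
      by (cases "\<integral>\<^sup>+x. ennreal (norm (f x) powr r) \<partial>lebesgue")
         (simp_all add: real Lq_norm_ennreal ennreal_powr_ennreal)
    then have "AE x in lebesgue. ennreal (norm (f x) powr r) = 0"
      using f by (subst (asm) nn_integral_0_iff_AE) auto
    then show ?thesis by (auto elim: eventually_mono)
  next
    case top
    then show ?thesis
      using esssup_AE[of "\<lambda>x. ennreal (norm (f x))" lebesgue] 0
      by (auto simp: Lq_norm_top elim: eventually_mono)
  qed
next
  assume "AE x in lebesgue. f x = 0"
  then have "Lq_norm q f = Lq_norm q (\<lambda>x::'a. 0)"
    by (intro Lq_norm_cong_AE f) simp_all
  also have "\<dots> \<le> ennreal 1 * 0"
  proof (cases q)
    case (real r)
    then show ?thesis using ennreal_powr_ennreal[of 0 "1 / r"] by (simp add: Lq_norm_ennreal)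
  next
    case top
    then show ?thesis
      using esssup_I[of "\<lambda>x. 0 :: ennreal" "lebesgue :: 'a measure" 0] by (simp add: Lq_norm_top)
  qed
  finally show "Lq_norm q f = 0" by simp
qed

lemma AE_lborel_shift:
  fixes P :: "'a::euclidean_space \<Rightarrow> bool"
  assumes [measurable]: "Measurable.pred borel P" and "AE x in lborel. P x"
  shows "AE x in lborel. P (x - a)"
proof -
  have "AE x in distr lborel borel ((+) (- a)). P x"
    unfolding lborel_distr_plus by fact
  then show ?thesis
    by (subst (asm) AE_distr_iff) auto
qed

text \<open>A sum is at most twice the larger summand, which avoids Minkowski's inequality. The
  index \<open>k\<close> depends on \<open>x\<close>, so all N + 1 shifted tails are added; each has
  the same integral.\<close>

lemma nn_integral_le_of_two_terms:
  fixes f g :: "'a::euclidean_space \<Rightarrow> complex" and r :: real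
  assumes r: "r > 0" and [measurable]: "f \<in> borel_measurable borel" "g \<in> borel_measurable borel" "out \<in> borel_measurable borel"
    and le: "\<And>x. \<exists>k\<le>N. norm (f x) \<le> norm (g x) + M * norm (out (x - real k *\<^sub>R h))"
    and M: "M > 0"
  shows "(\<integral>\<^sup>+x. ennreal (norm (f x) powr r) \<partial>lborel)
    \<le> ennreal (2 powr r) * (\<integral>\<^sup>+x. ennreal (norm (g x) powr r) \<partial>lborel)
      + ennreal ((2 * M) powr r * real (Suc N)) * (\<integral>\<^sup>+x. ennreal (norm (out x :: complex) powr r) \<partial>lborel)"
proof -
  have pt: "ennreal (norm (f x) powr r) \<le> ennreal (2 powr r) * ennreal (norm (g x) powr r)
      + (\<Sum>k\<le>N. ennreal ((2 * M) powr r) * ennreal (norm (out (x - real k *\<^sub>R h)) powr r))" for x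
  proof -
    obtain k where k: "k \<le> N" "norm (f x) \<le> norm (g x) + M * norm (out (x - real k *\<^sub>R h))"
      using le by blast
    let ?o = "\<lambda>k. norm (out (x - real k *\<^sub>R h))"
    have "norm (f x) powr r \<le> (2 * norm (g x)) powr r + (2 * M * ?o k) powr r"
    proof (cases "M * ?o k \<le> norm (g x)")
      case True
      then have "norm (f x) powr r \<le> (2 * norm (g x)) powr r"
        using k r by (intro powr_mono2) auto
      then show ?thesis
        by (rule order_trans) simp
    next
      case False
      then have "norm (f x) powr r \<le> (2 * M * ?o k) powr r"
        using k r by (intro powr_mono2) auto
      then show ?thesis
        by (rule order_trans) simp
    qed
    also have "\<dots> = 2 powr r * norm (g x) powr r + (2 * M) powr r * ?o k powr r"
      by (simp only: powr_mult)
    also have "\<dots> \<le> 2 powr r * norm (g x) powr r + (\<Sum>k\<le>N. (2 * M) powr r * ?o k powr r)"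
      using k(1) by (intro add_left_mono member_le_sum) auto
    finally have "ennreal (norm (f x) powr r)
        \<le> ennreal (2 powr r * norm (g x) powr r + (\<Sum>k\<le>N. (2 * M) powr r * ?o k powr r))"
      by (rule ennreal_leI)
    also have "\<dots> = ennreal (2 powr r) * ennreal (norm (g x) powr r)
      + (\<Sum>k\<le>N. ennreal ((2 * M) powr r) * ennreal (?o k powr r))"
      by (simp add: ennreal_plus sum_nonneg ennreal_mult flip: sum_ennreal)
    finally show ?thesis .
  qed
  have sh: "(\<integral>\<^sup>+x. ennreal (norm (out (x - a)) powr r) \<partial>lborel) = (\<integral>\<^sup>+x. ennreal (norm (out x) powr r) \<partial>lborel)" for a
    using nn_integral_shift(2)[of "\<lambda>x. ennreal (norm (out x) powr r)" a] by simp
  have "(\<integral>\<^sup>+x. ennreal (norm (f x) powr r) \<partial>lborel)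
    \<le> (\<integral>\<^sup>+x. ennreal (2 powr r) * ennreal (norm (g x) powr r)
      + (\<Sum>k\<le>N. ennreal ((2 * M) powr r) * ennreal (norm (out (x - real k *\<^sub>R h)) powr r)) \<partial>lborel)"
    by (intro nn_integral_mono pt)
  also have "\<dots> = ennreal (2 powr r) * (\<integral>\<^sup>+x. ennreal (norm (g x) powr r) \<partial>lborel)
      + (\<Sum>k\<le>N. ennreal ((2 * M) powr r) * (\<integral>\<^sup>+x. ennreal (norm (out x) powr r) \<partial>lborel))"
    by (simp add: nn_integral_add nn_integral_sum nn_integral_cmult sh)
  also have "(\<Sum>k\<le>N. ennreal ((2 * M) powr r) * (\<integral>\<^sup>+x. ennreal (norm (out x) powr r) \<partial>lborel))
     = ennreal ((2 * M) powr r * real (Suc N)) * (\<integral>\<^sup>+x. ennreal (norm (out x) powr r) \<partial>lborel)"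
    by (simp add: ennreal_mult mult_ac ennreal_of_nat_eq_real_of_nat)
  finally show ?thesis .
qed

lemma Lq_norm_ennreal_eqD:
  assumes "Lq_norm (ennreal r) f = ennreal F" "0 \<le> F" "0 < r"
  shows "(\<integral>\<^sup>+x. ennreal (norm (f x) powr r) \<partial>lborel) = ennreal (F powr r)"
proof (cases "\<integral>\<^sup>+x. ennreal (norm (f x) powr r) \<partial>lborel")
  case (real I)
  then have "I powr (1 / r) = F"
    using assms by (simp add: Lq_norm_ennreal nn_integral_completion ennreal_powr_ennreal)
  then have "F powr r = I"
    using assms real by (auto simp: powr_powr)
  then show ?thesis using real by simp
next
  case top
  then show ?thesis
    using assms by (simp add: Lq_norm_ennreal nn_integral_completion)
qed

text \<open>
  The constant \<open>2 ^ (N + 2) * (N + 1)\<close> makes the \<open>N + 1\<close> tail terms, each with weight \<open>2 ^ N\<close>, add up to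
  at most half of the left-hand side.
\<close>

lemma Lq_norm_absorb:
  fixes f :: "'a::euclidean_space \<Rightarrow> complex"
  assumes q: "1 \<le> q" and [measurable]: "f \<in> borel_measurable borel" "g \<in> borel_measurable borel" "out \<in> borel_measurable borel"
    and le: "\<And>x. \<exists>k\<le>N. norm (f x) \<le> norm (g x) + 2 ^ N * norm (out (x - real k *\<^sub>R h) :: complex)"
    and F: "Lq_norm q f = ennreal F" "0 < F"
    and out: "Lq_norm q out \<le> ennreal (F / (2 ^ (N + 2) * real (Suc N)))"
  shows "Lq_norm q f \<le> ennreal 4 * Lq_norm q g"
proof -
  \<comment> \<open>Used with P = 2 ^ N and S = N + 1, the factors of the tail constant: the first
    identity for the essential supremum, the second for finite exponents.\<close>
  have cancel: "P * (F / (P * 4 * S)) = F / (4 * S)" "2 * P * (F / (P * 4 * S)) = 1 / (2 * S) * F"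
    if "P > 0" "S > 0" for P S :: real
    using that by (simp_all add: field_simps)
  show ?thesis
  proof (cases q)
    case (real r)
    have r: "r \<ge> 1" using q real by (simp flip: ennreal_1)
    define c where "c = 2 ^ (N + 2) * real (Suc N)"
    have c: "c > 0" by (simp add: c_def)
    obtain Eo where Eo: "Lq_norm q out = ennreal Eo" "0 \<le> Eo" "Eo \<le> F / c"
      using out F c unfolding c_def[symmetric]
      by (cases "Lq_norm q out") (auto simp: top_unique)
    show ?thesis
    proof (cases "Lq_norm q g")
      case (real G)
      have If: "(\<integral>\<^sup>+x. ennreal (norm (f x) powr r) \<partial>lborel) = ennreal (F powr r)"
        and Ig: "(\<integral>\<^sup>+x. ennreal (norm (g x) powr r) \<partial>lborel) = ennreal (G powr r)"
        and Io: "(\<integral>\<^sup>+x. ennreal (norm (out x) powr r) \<partial>lborel) = ennreal (Eo powr r)"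
        using F Eo real r \<open>q = ennreal r\<close> by (simp_all add: Lq_norm_ennreal_eqD)
      have "ennreal (F powr r) \<le> ennreal (2 powr r) * ennreal (G powr r)
          + ennreal ((2 * 2 ^ N) powr r * real (Suc N)) * ennreal (Eo powr r)"
        using nn_integral_le_of_two_terms[of r f g out N "2 ^ N" h, OF _ _ _ _ le] r
        unfolding If Ig Io by simp
      also have "\<dots> = ennreal (2 powr r * G powr r + (2 * 2 ^ N) powr r * real (Suc N) * Eo powr r)"
        by (simp add: ennreal_plus ennreal_mult)
      finally have "F powr r \<le> 2 powr r * G powr r + (2 * 2 ^ N) powr r * real (Suc N) * Eo powr r"
        by (subst (asm) ennreal_le_iff) auto
      also have "(2 * 2 ^ N) powr r * real (Suc N) * Eo powr r \<le> F powr r / 2"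
      proof -
        have "(2 * 2 ^ N) powr r * real (Suc N) * Eo powr r \<le> (2 * 2 ^ N) powr r * real (Suc N) * (F / c) powr r"
          using Eo r by (intro mult_left_mono powr_mono2) auto
        also have "\<dots> = real (Suc N) * (2 * 2 ^ N * (F / c)) powr r"
          by (simp only: powr_mult) simp
        also have "2 * 2 ^ N * (F / c) = 1 / (2 * real (Suc N)) * F"
          using cancel(2)[of "2 ^ N" "real (Suc N)"] by (simp add: c_def power_add)
        also have "real (Suc N) * (1 / (2 * real (Suc N)) * F) powr r
            = real (Suc N) * (1 / (2 * real (Suc N))) powr r * F powr r"
          by (simp only: powr_mult mult.assoc)
        \<comment> \<open>Since \<open>r \<ge> 1\<close> and the base is at most 1, its r-th power
          is at most the base, so the N + 1 tails together contribute at most one half.\<close>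
        also have "\<dots> \<le> real (Suc N) * (1 / (2 * real (Suc N))) powr 1 * F powr r"
          using r by (intro mult_right_mono mult_left_mono powr_mono') auto
        also have "\<dots> = F powr r / 2"
          by (simp add: field_simps)
        finally show ?thesis .
      qed
      finally have "F powr r \<le> 2 * (2 powr r * G powr r)" by simp
      \<comment> \<open>The factor 2 left by absorption is enlarged to \<open>2 powr r\<close>, so
        that the root gives the constant 4 independently of \<open>r\<close>.\<close>
      also have "\<dots> \<le> 2 powr r * (2 powr r * G powr r)"
        using r powr_mono[of 1 r 2] by (intro mult_right_mono) auto
      also have "\<dots> = (2 * (2 * G)) powr r"
        by (simp only: powr_mult)
      finally have "F powr r \<le> (2 * (2 * G)) powr r" .
      then have "F \<le> 2 * (2 * G)"
        using r real F powr_less_mono2[of r "2 * (2 * G)" F] by (cases "F \<le> 2 * (2 * G)") auto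
      then show ?thesis
        using F real by (simp add: ennreal_leI flip: ennreal_mult ennreal_numeral)
    qed (simp add: ennreal_mult_top)
  next
    case top
    have ess: "AE x in lborel. ennreal (norm (v x)) \<le> Lq_norm q v" for v :: "'a \<Rightarrow> complex"
      using esssup_AE[of "\<lambda>x. ennreal (norm (v x))" lebesgue]
      by (simp add: top Lq_norm_top AE_completion_iff)
    have "AE x in lborel. ennreal (norm (out x)) \<le> ennreal (F / (2 ^ (N + 2) * real (Suc N)))"
      using ess[of out] by (rule eventually_mono) (use out in \<open>auto intro: order_trans\<close>)
    then have "AE x in lborel. norm (out x) \<le> F / (2 ^ (N + 2) * real (Suc N))"
      using F by (simp add: ennreal_le_iff)
    then have "AE x in lborel. norm (out (x - real k *\<^sub>R h)) \<le> F / (2 ^ (N + 2) * real (Suc N))" for k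
      by (intro AE_lborel_shift) measurable
    \<comment> \<open>There are countably many shifts, so one null set serves all of them; this
      matters because \<open>k\<close> varies with \<open>x\<close>.\<close>
    then have o: "AE x in lborel. \<forall>k. norm (out (x - real k *\<^sub>R h)) \<le> F / (2 ^ (N + 2) * real (Suc N))"
      by (simp add: AE_all_countable)
    show ?thesis
    proof (cases "Lq_norm q g")
      case (real G)
      have "AE x in lborel. norm (g x) \<le> G"
        using ess[of g] real by simp
      with o have "AE x in lborel. ennreal (norm (f x)) \<le> ennreal (G + F / 2)"
      proof eventually_elim
        case (elim x)
        obtain k where "norm (f x) \<le> norm (g x) + 2 ^ N * norm (out (x - real k *\<^sub>R h))"
          using le by blast
        also have "\<dots> \<le> G + 2 ^ N * (F / (2 ^ (N + 2) * real (Suc N)))"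
          using elim by (intro add_mono mult_left_mono) auto
        also have "2 ^ N * (F / (2 ^ (N + 2) * real (Suc N))) = F / (4 * real (Suc N))"
          using cancel(1)[of "2 ^ N" "real (Suc N)"] by (simp add: power_add)
        also have "\<dots> \<le> F / 2"
          using F by (intro divide_left_mono) auto
        finally show ?case by (simp add: ennreal_leI)
      qed
      then have "Lq_norm q f \<le> ennreal (G + F / 2)"
        by (auto simp: top Lq_norm_top AE_completion_iff intro!: esssup_I measurable_completion)
      then have "F \<le> G + F / 2"
        unfolding F(1) by (rule ennreal_le_iff[THEN iffD1, rotated]) (use F real in simp)
      then have "F \<le> 4 * G" using real F by linarith
      then show ?thesis
        using F real by (simp add: ennreal_leI flip: ennreal_mult ennreal_numeral)
    qed (simp add: ennreal_mult_top)
  qed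
qed

section \<open>The uncertainty inequality\<close>

lemma broken_ennreal_powr_ennreal:
  "0 \<le> s \<Longrightarrow> broken_ennreal_powr C (ennreal s) = ennreal (broken_powr C s)"
  using ennreal_less_iff[of s 1]
  by (simp add: broken_ennreal_powr_def broken_powr_def ennreal_powr_ennreal)

lemma conjugate_exponent_pos:
  fixes q q' :: ennreal
  assumes "2 \<le> q" "1 / q + 1 / q' = 1"
  shows "0 < q" "1 \<le> q" "0 < q'"
proof -
  show "1 \<le> q" using assms(1) by (rule order_trans[rotated]) simp
  then show "0 < q" by (rule less_le_trans[rotated]) simp
  show "0 < q'"
    using assms by (cases rule: conjugate_exponent_cases) auto
qed

text \<open>The estimate for a finite, positive weighted norm \<open>s\<close>. The Hausdorff-Young
  constant \<open>C\<close> is a parameter, which shows that the final constant involves only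
  \<open>C\<close>, \<open>N\<close>, \<open>A\<close> and \<open>B\<close>.\<close>

lemma Lq_norm_le_broken_weights:
  fixes f :: "'a::euclidean_space \<Rightarrow> complex" and q q' :: ennreal and A B :: "real \<times> real"
  assumes q: "2 \<le> q" "1 / q + 1 / q' = 1"
    and A: "0 < fst A" "0 < snd A" and B: "0 < fst B" "0 < snd B" "fst B \<le> real N" "snd B \<le> real N"
    and f: "integrable lborel f" and F: "Lq_norm q f = ennreal F" "0 < F"
    and C: "0 < C" "\<And>u :: 'a \<Rightarrow> complex. integrable lebesgue u \<Longrightarrow> Lq_norm q u \<le> ennreal C * Lq_norm q' (fourier u)"
    and s: "Lq_norm q (\<lambda>x. f x * complex_of_real (broken_powr A (norm x)) / complex_of_real F) = ennreal s" "0 < s"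
  defines "c \<equiv> 2 ^ (N + 2) * real (Suc N)"
  shows "Lq_norm q f \<le> ennreal (4 * C * (4 * pi) ^ N * c powr (snd B / fst A + fst B / snd A))
    * ennreal (broken_powr (snd B / fst A, fst B / snd A) s)
    * Lq_norm q' (\<lambda>\<xi>. fourier f \<xi> * complex_of_real (broken_powr B (norm \<xi>)))"
proof -
  note pos = conjugate_exponent_pos[OF q]
  have [measurable]: "f \<in> borel_measurable borel" using f by auto
  have c: "1 \<le> c"
    unfolding c_def by (intro mult_ge1_I one_le_power) simp_all
  let ?\<gamma> = "(snd B / fst A, fst B / snd A)"
  obtain R where R: "R > 0" "broken_powr A R = c * s"
    and RB: "1 / broken_powr B (1 / R) \<le> c powr (snd B / fst A + fst B / snd A) * broken_powr ?\<gamma> s"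
    by (rule broken_powr_scale[OF A B(1,2) c s(2)])
  \<comment> \<open>Any direction will do; only the length \<open>2 * R\<close> is used.\<close>
  define h where "h = (2 * R) *\<^sub>R (SOME b. b \<in> (Basis :: 'a set))"
  have h: "norm h = 2 * R"
    using R norm_Basis[OF SOME_Basis, where 'a='a] by (simp add: h_def)
  define out where "out x = (if norm x < R then 0 else f x)" for x
  have out_m[measurable]: "out \<in> borel_measurable borel"
    unfolding out_def by measurable
  define g where "g = shift_difference N h f"
  have ig: "integrable lborel g"
    unfolding g_def by (rule integrable_shift_difference[OF f])
  have gm[measurable]: "g \<in> borel_measurable borel" using ig by auto
  have le: "\<exists>k\<le>N. norm (f x) \<le> norm (g x) + 2 ^ N * norm (out (x - real k *\<^sub>R h))" for x
  proof -
    obtain k where "k \<le> N"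
      "norm (f x) \<le> norm (shift_difference N h f x) + 2 ^ N * norm (if norm (x - real k *\<^sub>R h) < R then 0 else f (x - real k *\<^sub>R h))"
      by (rule norm_le_shift_difference[OF R(1) h])
    then show ?thesis unfolding g_def out_def by blast
  qed
  have cs: "c * s > 0" using c s by simp
  have "Lq_norm q out \<le> ennreal (F / (c * s)) * Lq_norm q (\<lambda>x. f x * complex_of_real (broken_powr A (norm x)) / complex_of_real F)"
  proof (rule Lq_norm_le_cmult)
    have "norm (out x) \<le> F / (c * s) * norm (f x * complex_of_real (broken_powr A (norm x)) / complex_of_real F)" for x
    proof (cases "norm x < R")
      case True
      then show ?thesis using F cs by (simp add: out_def)
    next
      case False
      \<comment> \<open>Outside the ball the weight is at least
        \<open>broken_powr A R = c * s\<close>. Dividing by it, the factor \<open>s\<close> cancels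
        against the weighted norm and leaves a tail of size \<open>F / c\<close>.\<close>
      then have "c * s \<le> broken_powr A (norm x)"
        using A R broken_powr_mono[of A R "norm x"] by simp
      then have "norm (f x) * (c * s) \<le> norm (f x) * broken_powr A (norm x)"
        by (rule mult_left_mono) simp
      then show ?thesis
        using False F cs broken_powr_nonneg[of A "norm x"]
        by (simp add: out_def norm_mult norm_divide pos_le_divide_eq)
    qed
    then show "AE x in lebesgue. norm (out x) \<le> F / (c * s) * norm (f x * complex_of_real (broken_powr A (norm x)) / complex_of_real F)"
      by simp
  qed (use F cs pos in \<open>auto intro!: measurable_completion\<close>)
  also have "\<dots> = ennreal (F / c)"
    using F s(2) c unfolding s(1) by (subst ennreal_mult[symmetric]) auto
  finally have "Lq_norm q out \<le> ennreal (F / (2 ^ (N + 2) * real (Suc N)))"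
    by (simp only: c_def)
  from Lq_norm_absorb[OF pos(2) _ gm out_m le F this]
  have 1: "Lq_norm q f \<le> ennreal 4 * Lq_norm q g"
    by simp
  have 2: "Lq_norm q g \<le> ennreal C * Lq_norm q' (fourier g)"
    using ig by (intro C(2)) (simp add: integrable_completion)
  define b where "b = broken_powr B (1 / R)"
  have b: "b > 0" unfolding b_def using R by (intro broken_powr_pos) simp
  have 3: "Lq_norm q' (fourier g) \<le> ennreal ((4 * pi) ^ N / b)
      * Lq_norm q' (\<lambda>\<xi>. fourier f \<xi> * complex_of_real (broken_powr B (norm \<xi>)))"
  proof (rule Lq_norm_le_cmult)
    \<comment> \<open>The multiplier comparison is available for positive \<open>norm \<xi>\<close>;
      the origin is a null set.\<close>
    have "AE \<xi> in lborel. \<xi> \<noteq> (0::'a)"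
      by (rule AE_lborel_singleton)
    then have "AE \<xi> in lborel. norm (fourier g \<xi>)
        \<le> (4 * pi) ^ N / b * norm (fourier f \<xi> * complex_of_real (broken_powr B (norm \<xi>)))"
    proof eventually_elim
      case (elim \<xi>)
      have "norm (fourier g \<xi>) \<le> (4 * pi) ^ N * min 1 (R * norm \<xi>) ^ N * norm (fourier f \<xi>)"
        unfolding g_def by (rule norm_fourier_shift_difference_le[OF f h])
      also have "\<dots> \<le> (4 * pi) ^ N * (broken_powr B (norm \<xi>) / b) * norm (fourier f \<xi>)"
        unfolding b_def using elim R
        by (intro mult_right_mono mult_left_mono min_power_le_broken_powr B) auto
      finally show ?case
        by (simp add: norm_mult broken_powr_nonneg mult_ac)
    qed
    then show "AE \<xi> in lebesgue. norm (fourier g \<xi>)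
        \<le> (4 * pi) ^ N / b * norm (fourier f \<xi> * complex_of_real (broken_powr B (norm \<xi>)))"
      by (rule AE_completion)
  qed (use b pos in \<open>auto intro!: measurable_completion\<close>)
  have "Lq_norm q f \<le> ennreal 4 * (ennreal C * (ennreal ((4 * pi) ^ N / b)
      * Lq_norm q' (\<lambda>\<xi>. fourier f \<xi> * complex_of_real (broken_powr B (norm \<xi>)))))"
    by (intro order_trans[OF 1] mult_left_mono order_trans[OF 2] 3) simp_all
  also have "\<dots> = ennreal (4 * C * (4 * pi) ^ N * (1 / b))
      * Lq_norm q' (\<lambda>\<xi>. fourier f \<xi> * complex_of_real (broken_powr B (norm \<xi>)))"
  proof -
    have "0 \<le> C" "0 \<le> (4 * pi) ^ N / b" using C(1) b by auto
    then have "ennreal 4 * ennreal C * ennreal ((4 * pi) ^ N / b) = ennreal (4 * C * ((4 * pi) ^ N / b))"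
      by (simp only: ennreal_mult[symmetric] mult_nonneg_nonneg zero_le_numeral)
    also have "4 * C * ((4 * pi) ^ N / b) = 4 * C * (4 * pi) ^ N * (1 / b)"
      by simp
    finally have "ennreal 4 * ennreal C * ennreal ((4 * pi) ^ N / b) = ennreal (4 * C * (4 * pi) ^ N * (1 / b))" .
    then show ?thesis by (simp only: mult.assoc[symmetric])
  qed
  also have "\<dots> \<le> ennreal (4 * C * (4 * pi) ^ N * (c powr (snd B / fst A + fst B / snd A) * broken_powr ?\<gamma> s))
      * Lq_norm q' (\<lambda>\<xi>. fourier f \<xi> * complex_of_real (broken_powr B (norm \<xi>)))"
    using RB C(1) unfolding b_def by (intro mult_right_mono ennreal_leI mult_left_mono) auto
  also have "ennreal (4 * C * (4 * pi) ^ N * (c powr (snd B / fst A + fst B / snd A) * broken_powr ?\<gamma> s))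
      = ennreal (4 * C * (4 * pi) ^ N * c powr (snd B / fst A + fst B / snd A)) * ennreal (broken_powr ?\<gamma> s)"
    using C(1) by (subst ennreal_mult[symmetric]) (simp_all add: broken_powr_nonneg mult.assoc)
  finally show ?thesis .
qed

theorem corollary1p3:
  fixes q q' :: ennreal and A1 A2 B1 B2 :: real
  assumes "2 \<le> q" and "1 / q + 1 / q' = 1"
    and "A1 > 0" and "A2 > 0" and "B1 > 0" and "B2 > 0"
  shows "\<exists>K::real. K > 0 \<and>
    (\<forall>f :: real ^ 'n \<Rightarrow> complex.
       integrable lebesgue f \<longrightarrow> \<not> (AE x in lebesgue. f x = 0) \<longrightarrow> Lq_norm q f < \<infinity> \<longrightarrow>
       Lq_norm q f \<le> ennreal K
         * broken_ennreal_powr (B2 / A1, B1 / A2)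
             (Lq_norm q (\<lambda>x. f x * complex_of_real (broken_powr (A1, A2) (norm x))
                               / complex_of_real (enn2real (Lq_norm q f))))
         * Lq_norm q' (\<lambda>\<xi>. fourier f \<xi> * complex_of_real (broken_powr (B1, B2) (norm \<xi>))))"
proof -
  note pos = conjugate_exponent_pos[OF assms(1,2)]
  obtain C where C: "0 < C"
    "\<And>u :: real ^ 'n \<Rightarrow> complex. integrable lebesgue u \<Longrightarrow> Lq_norm q u \<le> ennreal C * Lq_norm q' (fourier u)"
    by (rule inverse_hausdorff_young[OF assms(1,2)]) (rule that, assumption+)
  \<comment> \<open>The order of the difference depends on \<open>B1\<close> and \<open>B2\<close>
    alone, so \<open>K\<close> does not depend on \<open>f\<close>.\<close>
  obtain N :: nat where N: "max B1 B2 \<le> real N"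
    using real_arch_simple by blast
  define c where "c = 2 ^ (N + 2) * real (Suc N)"
  define K where "K = 4 * C * (4 * pi) ^ N * c powr (B2 / A1 + B1 / A2)"
  have K: "K > 0" using C(1) by (simp add: K_def c_def)
  have main: "Lq_norm q f \<le> ennreal K
         * broken_ennreal_powr (B2 / A1, B1 / A2)
             (Lq_norm q (\<lambda>x. f x * complex_of_real (broken_powr (A1, A2) (norm x))
                               / complex_of_real (enn2real (Lq_norm q f))))
         * Lq_norm q' (\<lambda>\<xi>. fourier f \<xi> * complex_of_real (broken_powr (B1, B2) (norm \<xi>)))"
    if f: "integrable lborel f" and nz: "\<not> (AE x in lebesgue. f x = 0)" and fin: "Lq_norm q f < \<infinity>"
    for f :: "real ^ 'n \<Rightarrow> complex"
  proof -
    have [measurable]: "f \<in> borel_measurable borel" using f by auto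
    have fm: "f \<in> borel_measurable lebesgue"
      by (rule measurable_completion) simp
    have x0: "AE x in lebesgue. x \<noteq> (0 :: real ^ 'n)"
      by (rule AE_completion[OF AE_lborel_singleton])
    define F where "F = enn2real (Lq_norm q f)"
    have F: "Lq_norm q f = ennreal F"
      using fin by (simp add: F_def)
    have "Lq_norm q f \<noteq> 0"
      using nz Lq_norm_eq_0_iff[OF fm pos(1)] by simp
    then have F0: "F > 0"
      using F by (cases "F \<le> 0") (auto simp: ennreal_neg)
    let ?w = "\<lambda>x. f x * complex_of_real (broken_powr (A1, A2) (norm x)) / complex_of_real F"
    let ?v = "\<lambda>\<xi>. fourier f \<xi> * complex_of_real (broken_powr (B1, B2) (norm \<xi>))"
    have wm: "?w \<in> borel_measurable lebesgue" and vm: "?v \<in> borel_measurable lebesgue"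
      and fm': "fourier f \<in> borel_measurable lebesgue"
      by (rule measurable_completion; measurable)+
    \<comment> \<open>The weight is positive off the origin, so a nonzero \<open>f\<close> has a
      nonzero weighted norm; the choice of the radius needs this.\<close>
    have w0: "Lq_norm q ?w \<noteq> 0"
    proof
      assume "Lq_norm q ?w = 0"
      then have "AE x in lebesgue. ?w x = 0"
        using Lq_norm_eq_0_iff[OF wm pos(1)] by simp
      then have "AE x in lebesgue. f x = 0"
        using x0
      proof eventually_elim
        case (elim x)
        then show ?case
          using F0 broken_powr_pos[of "norm x" "(A1, A2)"] by auto
      qed
      with nz show False by simp
    qed
    \<comment> \<open>If this factor were 0, the transform would vanish almost everywhere and
      inverse Hausdorff-Young would give \<open>Lq_norm q f = 0\<close>. With an infinite weighted
      norm the right-hand side is therefore infinite and not 0 * \<infinity>.\<close>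
    have v0: "Lq_norm q' ?v \<noteq> 0"
    proof
      assume "Lq_norm q' ?v = 0"
      then have "AE \<xi> in lebesgue. ?v \<xi> = 0"
        using Lq_norm_eq_0_iff[OF vm pos(3)] by simp
      then have "AE \<xi> in lebesgue. fourier f \<xi> = 0"
        using x0
      proof eventually_elim
        case (elim \<xi>)
        then show ?case
          using broken_powr_pos[of "norm \<xi>" "(B1, B2)"] by auto
      qed
      then have "Lq_norm q' (fourier f) = 0"
        using Lq_norm_eq_0_iff[OF fm' pos(3)] by simp
      then have "Lq_norm q f = 0"
        using C(2)[of f] f by (simp add: integrable_completion)
      with \<open>Lq_norm q f \<noteq> 0\<close> show False by simp
    qed
    show ?thesis
    proof (cases "Lq_norm q ?w")
      case (real s)
      with w0 have s: "s > 0" by (cases "s = 0") auto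
      have "Lq_norm q f \<le> ennreal K * ennreal (broken_powr (B2 / A1, B1 / A2) s) * Lq_norm q' ?v"
        using Lq_norm_le_broken_weights[of q q' "(A1, A2)" "(B1, B2)" N f F C s, OF assms(1,2) _ _ _ _ _ _ f F F0 C]
          assms N real s by (simp add: K_def c_def)
      then show ?thesis
        using real s by (simp add: F_def broken_ennreal_powr_ennreal)
    next
      case top
      then have "broken_ennreal_powr (B2 / A1, B1 / A2) (Lq_norm q ?w) = top"
        by (simp add: broken_ennreal_powr_def)
      then show ?thesis
        using K v0 by (simp add: F_def ennreal_mult_top ennreal_top_mult)
    qed
  qed
  show ?thesis
  proof (intro exI[of _ K] conjI K allI impI)
    fix f :: "real ^ 'n \<Rightarrow> complex"
    assume f: "integrable lebesgue f" and nz: "\<not> (AE x in lebesgue. f x = 0)" and fin: "Lq_norm q f < \<infinity>"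
    have fm: "f \<in> borel_measurable lebesgue" using f by auto
    \<comment> \<open>Passing to a Borel representative changes neither the norms nor the
      transform.\<close>
    then obtain g where gm[measurable]: "g \<in> borel_measurable lborel" and "AE x in lborel. f x = g x"
      by (rule completion_ex_borel_measurable_complex)
    then have fg: "AE x in lebesgue. f x = g x"
      by (intro AE_completion)
    have gl: "g \<in> borel_measurable lebesgue"
      by (rule measurable_completion) simp
    have "integrable lebesgue g"
      by (rule integrable_cong_AE_imp[OF f gl]) (use fg in auto)
    then have g: "integrable lborel g"
      by (subst (asm) integrable_completion) auto
    have ng: "\<not> (AE x in lebesgue. g x = 0)"
    proof
      assume "AE x in lebesgue. g x = 0"
      with fg have "AE x in lebesgue. f x = 0"
        by eventually_elim simp
      with nz show False by simp
    qed
    have eq: "Lq_norm q f = Lq_norm q g"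
      by (rule Lq_norm_cong_AE[OF fg fm gl])
    have weight: "(\<lambda>x :: real ^ 'n. complex_of_real (broken_powr (A1, A2) (norm x))) \<in> borel_measurable lebesgue"
      by (rule measurable_completion) measurable
    have eqw: "Lq_norm q (\<lambda>x. f x * complex_of_real (broken_powr (A1, A2) (norm x)) / complex_of_real (enn2real (Lq_norm q f)))
      = Lq_norm q (\<lambda>x. g x * complex_of_real (broken_powr (A1, A2) (norm x)) / complex_of_real (enn2real (Lq_norm q g)))"
    proof (unfold eq, rule Lq_norm_cong_AE)
      show "AE x in lebesgue. f x * complex_of_real (broken_powr (A1, A2) (norm x)) / complex_of_real (enn2real (Lq_norm q g))
        = g x * complex_of_real (broken_powr (A1, A2) (norm x)) / complex_of_real (enn2real (Lq_norm q g))"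
        using fg by eventually_elim simp
    qed (use fm gl weight in auto)
    have fourier_eq: "fourier f = fourier g"
      using fourier_cong_AE[OF fg fm] gm by simp
    show "Lq_norm q f \<le> ennreal K
         * broken_ennreal_powr (B2 / A1, B1 / A2)
             (Lq_norm q (\<lambda>x. f x * complex_of_real (broken_powr (A1, A2) (norm x))
                               / complex_of_real (enn2real (Lq_norm q f))))
         * Lq_norm q' (\<lambda>\<xi>. fourier f \<xi> * complex_of_real (broken_powr (B1, B2) (norm \<xi>)))"
      unfolding eqw unfolding eq fourier_eq using main[OF g ng] fin eq by simp
  qed
qed

end
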